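(* Let $m$ be a nonzero integer and let $(k_j)_{j}$ be a sequence of nonzero integers each relatively prime to $m$. The sequence $(BS(m,k_j))_j$ is convergent in $\mathcal{G}_2$ if and only if one (and only one) of the following assertions holds: (a) $(k_j)_j$ is eventually constant; (b) $|k_j|\to\infty$ and, for every $h\geq 1$, $(k_j)_j$ is eventually constant modulo $m^h$.
   Context: For nonzero integers $m,n$, $BS(m,n)=\langle a,b\mid ab^{m}a^{-1}=b^{n}\rangle$, marked by $(a,b)$. A marked group on $k$ generators is a pair $(\Gamma,S)$ with $\Gamma$ a group and $S=(s_1,\dots,s_k)$ a family generating $\Gamma$. Two marked groups $(\Gamma,S)$, $(\Gamma',S')$ are identified if there is a group isomorphism $\Gamma\to\Gamma'$ sending $s_i$ to $s'_i$ for each $i$; $\mathcal{G}_k$ is the set of marked groups on $k$ generators up to this identification. The topology on $\mathcal{G}_k$ is given by the ultrametric $d\big((\Gamma_1,S_1),(\Gamma_2,S_2)\big)=e^{-\lambda}$ for distinct marked groups, where $\lambda$ is the length of a shortest element of the free group $\mathbb{F}_k$ which is trivial in one of the groups and not in the other (under the canonical epimorphisms from $\mathbb{F}_k$). *)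

theory Defs
  imports
    "HOL-Analysis.Analysis"
    "HOL-Algebra.Generated_Groups"
    "HOL-Number_Theory.Cong"
begin

text \<open>The letter \<open>(i, True)\<close> is the generator \<open>x\<^sub>i\<close> (indices start at 0) and
  \<open>(i, False)\<close> is its inverse. Elements of a free group are reduced words, so the
  length of an element is the length of the list.\<close>

type_synonym word = "(nat \<times> bool) list"

definition letter_inv :: "nat \<times> bool \<Rightarrow> nat \<times> bool" where
  "letter_inv x = (fst x, \<not> snd x)"

definition reduced :: "word \<Rightarrow> bool" where
  "reduced = successively (\<lambda>x y. y \<noteq> letter_inv x)"

fun red_cons :: "nat \<times> bool \<Rightarrow> word \<Rightarrow> word" where
  "red_cons x [] = [x]"
| "red_cons x (y # w) = (if y = letter_inv x then w else x # y # w)"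

definition reduce :: "word \<Rightarrow> word" where
  "reduce w = foldr red_cons w []"

definition free_group :: "nat \<Rightarrow> word monoid" where
  "free_group k =
    \<lparr>carrier = {w. reduced w \<and> fst ` set w \<subseteq> {..<k}},
     monoid.mult = (\<lambda>u v. reduce (u @ v)), one = []\<rparr>"

definition free_gen :: "nat \<Rightarrow> word" where
  "free_gen i = [(i, True)]"

lemma letter_inv_inv [simp]: "letter_inv (letter_inv x) = x"
  by (simp add: letter_inv_def)

lemma letter_inv_neq [simp]: "letter_inv x \<noteq> x"
  by (simp add: letter_inv_def prod_eq_iff)

lemma letter_inv_eq_iff: "x = letter_inv y \<longleftrightarrow> y = letter_inv x"
  by auto

lemma fst_letter_inv [simp]: "fst (letter_inv x) = fst x"
  by (simp add: letter_inv_def)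

lemma reduced_Nil [simp]: "reduced []"
  by (simp add: reduced_def)

lemma reduced_Cons:
  "reduced (x # w) \<longleftrightarrow> reduced w \<and> (case w of [] \<Rightarrow> True | y # _ \<Rightarrow> y \<noteq> letter_inv x)"
  by (cases w) (auto simp: reduced_def)

lemma red_cons_eq_Cons: "reduced (x # w) \<Longrightarrow> red_cons x w = x # w"
  by (cases w) (auto simp: reduced_Cons)

lemma reduced_red_cons: "reduced w \<Longrightarrow> reduced (red_cons x w)"
  by (cases w) (auto simp: reduced_Cons)

lemma set_red_cons: "set (red_cons x w) \<subseteq> insert x (set w)"
  by (cases w) auto

lemma red_cons_cancel:
  assumes "reduced w"
  shows "red_cons x (red_cons (letter_inv x) w) = w"
proof (cases w)
  case (Cons y v)
  show ?thesis
  proof (cases "y = x")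
    case True
    then show ?thesis
      using assms Cons by (simp add: red_cons_eq_Cons)
  next
    case False
    then show ?thesis
      using Cons by simp
  qed
qed simp

lemma reduced_reduce: "reduced (reduce w)"
  by (induction w) (auto simp: reduce_def intro: reduced_red_cons)

lemma set_reduce: "set (reduce w) \<subseteq> set w"
proof (induction w)
  case (Cons x w)
  then show ?case
    using set_red_cons[of x "reduce w"] by (auto simp: reduce_def)
qed (simp add: reduce_def)

lemma reduce_reduced: "reduced w \<Longrightarrow> reduce w = w"
proof (induction w)
  case (Cons x w)
  then show ?case
    using red_cons_eq_Cons[of x w] by (auto simp: reduce_def reduced_Cons)
qed (simp add: reduce_def)

lemma reduce_append: "reduce (u @ v) = foldr red_cons u (reduce v)"
  by (simp add: reduce_def)

lemma foldr_red_cons: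
  assumes "reduced z"
  shows "foldr red_cons (red_cons x w) z = red_cons x (foldr red_cons w z)"
proof (cases w)
  case (Cons y v)
  have "reduced (foldr red_cons v z)"
    using assms by (induction v) (auto intro: reduced_red_cons)
  then show ?thesis
    using Cons red_cons_cancel by auto
qed simp

lemma reduce_append_reduce: "reduce (reduce u @ v) = reduce (u @ v)"
proof (induction u)
  case (Cons x u)
  have "reduce (reduce (x # u) @ v) = foldr red_cons (red_cons x (reduce u)) (reduce v)"
    by (simp add: reduce_append) (simp add: reduce_def)
  also have "\<dots> = red_cons x (foldr red_cons (reduce u) (reduce v))"
    by (rule foldr_red_cons[OF reduced_reduce])
  also have "\<dots> = reduce (x # u @ v)"
    using Cons.IH by (simp add: reduce_append) (simp add: reduce_def)
  finally show ?case
    by simp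
qed (simp add: reduce_def)

lemma reduce_append_reduce2: "reduce (u @ reduce v) = reduce (u @ v)"
  by (simp add: reduce_append reduce_reduced reduced_reduce)

lemma reduce_inverse: "reduce (rev (map letter_inv w) @ w) = []"
proof (induction w)
  case (Cons x w)
  have "foldr red_cons [letter_inv x, x] (reduce w) = reduce w"
    using red_cons_cancel[OF reduced_reduce, of "letter_inv x" w] by simp
  then have "reduce (rev (map letter_inv (x # w)) @ x # w) = reduce (rev (map letter_inv w) @ w)"
    by (simp add: reduce_append) (simp add: reduce_def)
  then show ?case
    using Cons.IH by simp
qed (simp add: reduce_def)

lemma reduced_rev_inv: "reduced w \<Longrightarrow> reduced (rev (map letter_inv w))"
  by (auto simp: reduced_def successively_map letter_inv_eq_iff
      elim!: successively_mono)

lemma group_free_group: "group (free_group k)"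
proof (rule groupI)
  fix u v assume "u \<in> carrier (free_group k)" "v \<in> carrier (free_group k)"
  then show "u \<otimes>\<^bsub>free_group k\<^esub> v \<in> carrier (free_group k)"
    using image_mono[OF set_reduce[of "u @ v"], of fst]
    by (simp add: free_group_def reduced_reduce image_Un) (meson Un_least subset_trans)
next
  fix u assume u: "u \<in> carrier (free_group k)"
  show "\<exists>v\<in>carrier (free_group k). v \<otimes>\<^bsub>free_group k\<^esub> u = \<one>\<^bsub>free_group k\<^esub>"
  proof (rule bexI[where x = "rev (map letter_inv u)"])
    show "rev (map letter_inv u) \<in> carrier (free_group k)"
      using u reduced_rev_inv by (auto simp: free_group_def)
  qed (simp add: free_group_def reduce_inverse)
qed (auto simp: free_group_def reduce_append_reduce reduce_append_reduce2 reduce_reduced)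

lemma free_gen_closed: "i < k \<Longrightarrow> free_gen i \<in> carrier (free_group k)"
  by (simp add: free_gen_def free_group_def reduced_def)

lemma free_gen_inv: "i < k \<Longrightarrow> inv\<^bsub>free_group k\<^esub> free_gen i = [(i, False)]"
  by (rule group.inv_equality[OF group_free_group])
    (simp_all add: free_gen_def free_group_def reduced_def reduce_def letter_inv_def)

lemma generate_free_group:
  "generate (free_group k) (free_gen ` {..<k}) = carrier (free_group k)"
proof
  interpret F: group "free_group k" by (rule group_free_group)
  have gens: "free_gen ` {..<k} \<subseteq> carrier (free_group k)"
    by (auto simp: free_gen_closed)
  show "generate (free_group k) (free_gen ` {..<k}) \<subseteq> carrier (free_group k)"
    by (rule F.generate_incl[OF gens])
  show "carrier (free_group k) \<subseteq> generate (free_group k) (free_gen ` {..<k})"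
  proof
    fix w assume "w \<in> carrier (free_group k)"
    then show "w \<in> generate (free_group k) (free_gen ` {..<k})"
    proof (induction w)
      case Nil
      then show ?case
        using generate.one[of "free_group k"] by (simp add: free_group_def)
    next
      case (Cons x w)
      obtain i e where x: "x = (i, e)" by fastforce
      have i: "i < k" and w: "w \<in> carrier (free_group k)" and red: "reduced (x # w)"
        using Cons.prems x by (auto simp: free_group_def reduced_Cons)
      have "[x] \<in> generate (free_group k) (free_gen ` {..<k})"
        using generate.incl[of "free_gen i" "free_gen ` {..<k}" "free_group k"]
          generate.inv[of "free_gen i" "free_gen ` {..<k}" "free_group k"] i x
        by (cases e) (auto simp: free_gen_inv simp flip: free_gen_def)
      moreover have "[x] \<otimes>\<^bsub>free_group k\<^esub> w = x # w"
        using reduce_reduced[OF red] by (simp add: free_group_def)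
      ultimately show ?case
        using generate.eng[OF _ Cons.IH[OF w]] by metis
    qed
  qed
qed

type_synonym 'a marked = "'a monoid \<times> 'a list"

definition marked_group :: "nat \<Rightarrow> 'a marked \<Rightarrow> bool" where
  "marked_group k X \<longleftrightarrow>
    group (fst X) \<and> length (snd X) = k \<and> set (snd X) \<subseteq> carrier (fst X) \<and>
    generate (fst X) (set (snd X)) = carrier (fst X)"

definition marked_iso :: "'a marked \<Rightarrow> 'b marked \<Rightarrow> bool" where
  "marked_iso X Y \<longleftrightarrow> (\<exists>\<phi> \<in> iso (fst X) (fst Y). map \<phi> (snd X) = snd Y)"

text \<open>On the free group, \<open>word_eval X\<close> is the canonical epimorphism onto the marked
  group \<open>X\<close>; see \<open>word_eval_hom\<close>, \<open>word_eval_gen\<close> and \<open>word_eval_surj\<close>.\<close>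

definition word_eval :: "'a marked \<Rightarrow> word \<Rightarrow> 'a" where
  "word_eval X w =
    foldr (\<lambda>(i, e) g. (if e then snd X ! i else inv\<^bsub>fst X\<^esub> (snd X ! i)) \<otimes>\<^bsub>fst X\<^esub> g) w \<one>\<^bsub>fst X\<^esub>"

definition word_trivial :: "'a marked \<Rightarrow> word \<Rightarrow> bool" where
  "word_trivial X w \<longleftrightarrow> word_eval X w = \<one>\<^bsub>fst X\<^esub>"

text \<open>HOL has no collection of all groups over all types, so the representatives of the
  points of \<open>marked_space k\<close> have carriers in the fixed type \<open>word set\<close>, in which quotients
  of \<open>free_group k\<close> live. No marked group is lost: see \<open>marked_group_representative\<close>.\<close>

definition marked_iso_rel :: "nat \<Rightarrow> (word set marked \<times> word set marked) set" where
  "marked_iso_rel k = {(X, Y). marked_group k X \<and> marked_group k Y \<and> marked_iso X Y}"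

definition marked_space :: "nat \<Rightarrow> word set marked set set" where
  "marked_space k = {X. marked_group k X} // marked_iso_rel k"

definition marked_class :: "nat \<Rightarrow> word set marked \<Rightarrow> word set marked set" where
  "marked_class k X = marked_iso_rel k `` {X}"

text \<open>Whether a word is trivial does not depend on the representatives \<open>X\<close> and \<open>Y\<close>; see
  \<open>marked_dist_class\<close>.\<close>

definition marked_dist :: "nat \<Rightarrow> word set marked set \<Rightarrow> word set marked set \<Rightarrow> real" where
  "marked_dist k P Q =
    (if P = Q then 0
     else exp (- real (LEAST l. \<exists>X\<in>P. \<exists>Y\<in>Q. \<exists>w\<in>carrier (free_group k).
            length w = l \<and> word_trivial X w \<noteq> word_trivial Y w)))"

definition marked_topology :: "nat \<Rightarrow> word set marked set topology" where
  "marked_topology k = Metric_space.mtopology (marked_space k) (marked_dist k)"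

definition normal_closure :: "('a, 'b) monoid_scheme \<Rightarrow> 'a set \<Rightarrow> 'a set" where
  "normal_closure G R = \<Inter> {N. N \<lhd> G \<and> R \<subseteq> N}"

definition free_quotient :: "nat \<Rightarrow> word set \<Rightarrow> word set marked" where
  "free_quotient k N =
    (free_group k Mod N, map (\<lambda>i. N #>\<^bsub>free_group k\<^esub> free_gen i) [0..<k])"

definition presented :: "nat \<Rightarrow> word set \<Rightarrow> word set marked" where
  "presented k R = free_quotient k (normal_closure (free_group k) R)"

definition BS_relator :: "int \<Rightarrow> int \<Rightarrow> word" where
  "BS_relator m n =
    (let F = free_group 2; a = free_gen 0; b = free_gen 1
     in a \<otimes>\<^bsub>F\<^esub> (b [^]\<^bsub>F\<^esub> m) \<otimes>\<^bsub>F\<^esub> inv\<^bsub>F\<^esub> a \<otimes>\<^bsub>F\<^esub> inv\<^bsub>F\<^esub> (b [^]\<^bsub>F\<^esub> n))"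

definition BS :: "int \<Rightarrow> int \<Rightarrow> word set marked set" where
  "BS m n = marked_class 2 (presented 2 {BS_relator m n})"

lemma word_eval_Nil [simp]: "word_eval X [] = \<one>\<^bsub>fst X\<^esub>"
  by (simp add: word_eval_def)

lemma word_eval_Cons [simp]:
  "word_eval X ((i, e) # w) =
    (if e then snd X ! i else inv\<^bsub>fst X\<^esub> (snd X ! i)) \<otimes>\<^bsub>fst X\<^esub> word_eval X w"
  by (simp add: word_eval_def)

lemma word_eval_closed:
  assumes X: "marked_group k X" and "fst ` set w \<subseteq> {..<k}"
  shows "word_eval X w \<in> carrier (fst X)"
proof -
  interpret G: group "fst X" using X by (simp add: marked_group_def)
  have S: "snd X ! i \<in> carrier (fst X)" if "i < k" for i
    using X that by (auto simp: marked_group_def)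
  show ?thesis
    using assms(2) by (induction w) (auto simp: S)
qed

lemma word_eval_append:
  assumes X: "marked_group k X" and "fst ` set u \<subseteq> {..<k}" "fst ` set v \<subseteq> {..<k}"
  shows "word_eval X (u @ v) = word_eval X u \<otimes>\<^bsub>fst X\<^esub> word_eval X v"
proof -
  interpret G: group "fst X" using X by (simp add: marked_group_def)
  have S: "snd X ! i \<in> carrier (fst X)" if "i < k" for i
    using X that by (auto simp: marked_group_def)
  show ?thesis
    using assms(2)
    by (induction u)
      (auto simp: S G.m_assoc word_eval_closed[OF X] word_eval_closed[OF X assms(3)])
qed

lemma word_eval_red_cons:
  assumes X: "marked_group k X" and i: "fst x < k" and w: "fst ` set w \<subseteq> {..<k}"
  shows "word_eval X (red_cons x w) = word_eval X (x # w)"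
proof (cases w)
  case (Cons y v)
  interpret G: group "fst X" using X by (simp add: marked_group_def)
  have S: "snd X ! fst x \<in> carrier (fst X)"
    using X i by (auto simp: marked_group_def)
  have v: "word_eval X v \<in> carrier (fst X)"
    using w Cons by (intro word_eval_closed[OF X]) auto
  show ?thesis
    using S v Cons
    by (cases x; cases y) (auto simp: letter_inv_def G.m_assoc[symmetric])
qed simp

lemma word_eval_reduce:
  assumes X: "marked_group k X" and "fst ` set w \<subseteq> {..<k}"
  shows "word_eval X (reduce w) = word_eval X w"
  using assms(2)
proof (induction w)
  case (Cons x w)
  have "fst ` set (reduce w) \<subseteq> {..<k}"
    using Cons.prems set_reduce[of w] by auto
  then have "word_eval X (red_cons x (reduce w)) = word_eval X (x # reduce w)"
    using Cons.prems by (intro word_eval_red_cons[OF X]) auto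
  also have "\<dots> = word_eval X (x # w)"
    using Cons by (cases x) simp
  finally show ?case
    by (simp add: reduce_def)
qed (simp add: reduce_def)

lemma word_eval_hom:
  assumes "marked_group k X"
  shows "word_eval X \<in> hom (free_group k) (fst X)"
proof (rule homI)
  fix u v assume "u \<in> carrier (free_group k)" "v \<in> carrier (free_group k)"
  then show "word_eval X (u \<otimes>\<^bsub>free_group k\<^esub> v) = word_eval X u \<otimes>\<^bsub>fst X\<^esub> word_eval X v"
    using word_eval_reduce[OF assms, of "u @ v"] word_eval_append[OF assms, of u v]
    by (auto simp: free_group_def image_Un)
qed (auto simp: free_group_def intro: word_eval_closed[OF assms])

lemma word_eval_gen:
  assumes "marked_group k X" "i < k"
  shows "word_eval X (free_gen i) = snd X ! i"
proof -
  interpret G: group "fst X" using assms by (simp add: marked_group_def)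
  have "snd X ! i \<in> carrier (fst X)"
    using assms by (auto simp: marked_group_def)
  then show ?thesis
    by (simp add: free_gen_def)
qed

lemma map_word_eval_gen:
  assumes "marked_group k X"
  shows "map (\<lambda>i. word_eval X (free_gen i)) [0..<k] = snd X"
  using assms by (auto simp: word_eval_gen list_eq_iff_nth_eq marked_group_def)

lemma group_hom_word_eval:
  "marked_group k X \<Longrightarrow> group_hom (free_group k) (fst X) (word_eval X)"
  by (simp add: group_hom_def group_hom_axioms_def group_free_group word_eval_hom
      marked_group_def)

lemma word_eval_surj:
  assumes "marked_group k X"
  shows "word_eval X ` carrier (free_group k) = carrier (fst X)"
proof -
  interpret h: group_hom "free_group k" "fst X" "word_eval X"
    by (rule group_hom_word_eval[OF assms])
  have "free_gen ` {..<k} \<subseteq> carrier (free_group k)"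
    by (auto simp: free_gen_closed)
  moreover have "word_eval X ` free_gen ` {..<k} = set (snd X)"
    using arg_cong[OF map_word_eval_gen[OF assms], of set]
    by (simp add: lessThan_atLeast0 image_image)
  ultimately show ?thesis
    using h.generate_img[of "free_gen ` {..<k}"] assms
    by (simp add: generate_free_group marked_group_def)
qed

lemma normal_closure_normal:
  assumes "group G" "R \<subseteq> carrier G"
  shows "normal_closure G R \<lhd> G"
proof -
  interpret group G by fact
  let ?A = "{N. N \<lhd> G \<and> R \<subseteq> N}"
  have "carrier G \<in> ?A"
    using assms normal_invI[OF subgroup_self] by auto
  then have "subgroup (\<Inter>?A) G"
    by (intro subgroups_Inter) (auto simp: normal_imp_subgroup)
  then show ?thesis
    unfolding normal_closure_def
    by (rule normal_invI) (auto intro: normal.inv_op_closed2)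
qed

lemma marked_group_free_quotient:
  assumes "N \<lhd> free_group k"
  shows "marked_group k (free_quotient k N)"
proof -
  interpret N: normal N "free_group k" by fact
  interpret h: group_hom "free_group k" "free_group k Mod N" "\<lambda>a. N #>\<^bsub>free_group k\<^esub> a"
    by (simp add: group_hom_def group_hom_axioms_def group_free_group N.factorgroup_is_group
        N.r_coset_hom_Mod)
  have gens: "free_gen ` {..<k} \<subseteq> carrier (free_group k)"
    by (auto simp: free_gen_closed)
  have set: "set (snd (free_quotient k N)) = (\<lambda>a. N #>\<^bsub>free_group k\<^esub> a) ` free_gen ` {..<k}"
    by (auto simp: free_quotient_def)
  have "(\<lambda>a. N #>\<^bsub>free_group k\<^esub> a) ` free_gen ` {..<k} \<subseteq> carrier (free_group k Mod N)"
    using gens by (auto simp: carrier_FactGroup)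
  then show ?thesis
    using h.generate_img[OF gens] unfolding marked_group_def set
    by (simp add: free_quotient_def N.factorgroup_is_group generate_free_group
        carrier_FactGroup)
qed

lemma marked_group_presented:
  "R \<subseteq> carrier (free_group k) \<Longrightarrow> marked_group k (presented k R)"
  unfolding presented_def
  by (intro marked_group_free_quotient normal_closure_normal group_free_group)

lemma marked_iso_refl: "marked_iso X X"
  using iso_set_refl[of "fst X"] by (auto simp: marked_iso_def intro!: bexI[where x = "\<lambda>x. x"])

lemma marked_iso_sym:
  assumes "marked_group k X" "marked_iso X Y"
  shows "marked_iso Y X"
proof -
  interpret G: group "fst X" using assms by (simp add: marked_group_def)
  obtain \<phi> where \<phi>: "\<phi> \<in> iso (fst X) (fst Y)" "map \<phi> (snd X) = snd Y"
    using assms by (auto simp: marked_iso_def)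
  let ?\<psi> = "inv_into (carrier (fst X)) \<phi>"
  have "inj_on \<phi> (carrier (fst X))" "set (snd X) \<subseteq> carrier (fst X)"
    using \<phi> assms by (auto simp: iso_def bij_betw_def marked_group_def)
  then have "map ?\<psi> (snd Y) = snd X"
    by (auto simp: \<phi>(2)[symmetric] inv_into_f_f subsetD intro!: map_idI)
  then show ?thesis
    using G.iso_set_sym[OF \<phi>(1)] by (auto simp: marked_iso_def)
qed

lemma marked_iso_trans:
  assumes "marked_iso X Y" "marked_iso Y Z"
  shows "marked_iso X Z"
proof -
  obtain \<phi> \<psi> where "\<phi> \<in> iso (fst X) (fst Y)" "map \<phi> (snd X) = snd Y"
    "\<psi> \<in> iso (fst Y) (fst Z)" "map \<psi> (snd Y) = snd Z"
    using assms by (auto simp: marked_iso_def)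
  then have "\<psi> \<circ> \<phi> \<in> iso (fst X) (fst Z)" "map (\<psi> \<circ> \<phi>) (snd X) = snd Z"
    by (auto intro: iso_set_trans simp flip: map_map)
  then show ?thesis
    unfolding marked_iso_def by blast
qed

lemma marked_iso_free_quotient:
  assumes X: "marked_group k X"
  defines "N \<equiv> {w \<in> carrier (free_group k). word_trivial X w}"
  shows "marked_group k (free_quotient k N)" "marked_iso (free_quotient k N) X"
proof -
  interpret h: group_hom "free_group k" "fst X" "word_eval X"
    by (rule group_hom_word_eval[OF X])
  have N: "N = kernel (free_group k) (fst X) (word_eval X)"
    by (auto simp: N_def kernel_def word_trivial_def)
  show "marked_group k (free_quotient k N)"
    unfolding N by (rule marked_group_free_quotient[OF h.normal_kernel])
  let ?\<phi> = "\<lambda>C. the_elem (word_eval X ` C)"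
  have iso: "?\<phi> \<in> iso (free_group k Mod N) (fst X)"
    unfolding N by (rule h.FactGroup_iso_set[OF word_eval_surj[OF X]])
  have "?\<phi> (N #>\<^bsub>free_group k\<^esub> w) = word_eval X w" if w: "w \<in> carrier (free_group k)" for w
  proof -
    have "word_eval X ` (N #>\<^bsub>free_group k\<^esub> w) = {word_eval X w}"
    proof
      show "word_eval X ` (N #>\<^bsub>free_group k\<^esub> w) \<subseteq> {word_eval X w}"
        using w by (auto simp: r_coset_def N kernel_def)
      have "\<one>\<^bsub>free_group k\<^esub> \<in> N"
        by (simp add: N kernel_def)
      then have "w \<in> N #>\<^bsub>free_group k\<^esub> w"
        using w by (force simp: r_coset_def)
      then show "{word_eval X w} \<subseteq> word_eval X ` (N #>\<^bsub>free_group k\<^esub> w)"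
        by blast
    qed
    then show ?thesis
      by simp
  qed
  then have "map ?\<phi> (snd (free_quotient k N)) = map (\<lambda>i. word_eval X (free_gen i)) [0..<k]"
    by (simp add: free_quotient_def free_gen_closed)
  then show "marked_iso (free_quotient k N) X"
    using iso map_word_eval_gen[OF X]
    by (auto simp: marked_iso_def free_quotient_def)
qed

theorem marked_group_representative:
  fixes X :: "'a marked"
  assumes "marked_group k X"
  shows "\<exists>Y :: word set marked. marked_group k Y \<and> marked_iso X Y"
  using marked_iso_free_quotient[OF assms] marked_iso_sym by blast

theorem marked_iso_iff_word_trivial:
  fixes X :: "'a marked" and Y :: "'b marked"
  assumes X: "marked_group k X" and Y: "marked_group k Y"
  shows "marked_iso X Y \<longleftrightarrow>
    (\<forall>w\<in>carrier (free_group k). word_trivial X w \<longleftrightarrow> word_trivial Y w)"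
proof
  assume "marked_iso X Y"
  then obtain \<phi> where \<phi>: "\<phi> \<in> iso (fst X) (fst Y)" "map \<phi> (snd X) = snd Y"
    by (auto simp: marked_iso_def)
  interpret G: group "fst X" using X by (simp add: marked_group_def)
  interpret h: group_hom "fst X" "fst Y" \<phi>
    using X Y \<phi> by (simp add: group_hom_def group_hom_axioms_def marked_group_def iso_def)
  have eval: "\<phi> (word_eval X w) = word_eval Y w" if "fst ` set w \<subseteq> {..<k}" for w
    using that
  proof (induction w)
    case (Cons x w)
    obtain i e where x: "x = (i, e)" by fastforce
    have "snd X ! i \<in> carrier (fst X)" "i < length (snd X)"
      using X Cons.prems x by (auto simp: marked_group_def)
    moreover have "word_eval X w \<in> carrier (fst X)"
      using Cons.prems by (intro word_eval_closed[OF X]) auto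
    moreover have "snd Y ! i = \<phi> (snd X ! i)"
      using calculation \<phi>(2) by (metis nth_map)
    ultimately show ?case
      using Cons x by simp
  qed simp
  show "\<forall>w\<in>carrier (free_group k). word_trivial X w \<longleftrightarrow> word_trivial Y w"
  proof
    fix w assume "w \<in> carrier (free_group k)"
    then have w: "fst ` set w \<subseteq> {..<k}" by (simp add: free_group_def)
    have inj: "inj_on \<phi> (carrier (fst X))"
      using \<phi> by (simp add: iso_def bij_betw_def)
    show "word_trivial X w \<longleftrightarrow> word_trivial Y w"
      using inj_on_eq_iff[OF inj word_eval_closed[OF X w] G.one_closed]
      by (simp add: word_trivial_def eval[OF w])
  qed
next
  assume "\<forall>w\<in>carrier (free_group k). word_trivial X w \<longleftrightarrow> word_trivial Y w"
  then have eq: "{w \<in> carrier (free_group k). word_trivial X w} =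
      {w \<in> carrier (free_group k). word_trivial Y w}"
    by blast
  show "marked_iso X Y"
    by (rule marked_iso_trans[OF marked_iso_sym[OF marked_iso_free_quotient[OF X]]])
      (unfold eq, rule marked_iso_free_quotient(2)[OF Y])
qed

lemma equiv_marked_iso_rel: "equiv {X. marked_group k X} (marked_iso_rel k)"
proof (rule equivI)
  show "refl_on {X. marked_group k X} (marked_iso_rel k)"
    by (auto simp: marked_iso_rel_def refl_on_def marked_iso_refl)
  show "sym (marked_iso_rel k)"
    by (rule symI) (use marked_iso_sym in \<open>auto simp: marked_iso_rel_def\<close>)
  show "trans (marked_iso_rel k)"
    by (rule transI) (use marked_iso_trans in \<open>auto simp: marked_iso_rel_def\<close>)
qed (auto simp: marked_iso_rel_def)

lemma marked_class_in_space: "marked_group k X \<Longrightarrow> marked_class k X \<in> marked_space k"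
  by (auto simp: marked_class_def marked_space_def intro: quotientI)

lemma marked_space_cases:
  assumes "P \<in> marked_space k"
  obtains X where "marked_group k X" "P = marked_class k X"
  using assms by (auto simp: marked_class_def marked_space_def elim!: quotientE)

lemma marked_class_eq_iff:
  assumes "marked_group k X" "marked_group k Y"
  shows "marked_class k X = marked_class k Y \<longleftrightarrow> marked_iso X Y"
  using eq_equiv_class_iff[OF equiv_marked_iso_rel] assms
  by (auto simp: marked_class_def marked_iso_rel_def)

lemma marked_dist_class:
  assumes X: "marked_group k X" and Y: "marked_group k Y"
  shows "marked_dist k (marked_class k X) (marked_class k Y) =
    (if marked_iso X Y then 0
     else exp (- real (LEAST l. \<exists>w\<in>carrier (free_group k).
            length w = l \<and> word_trivial X w \<noteq> word_trivial Y w)))"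
proof -
  have triv: "word_trivial X' w = word_trivial Z w"
    if "X' \<in> marked_class k Z" "w \<in> carrier (free_group k)" for X' Z w
    using that marked_iso_iff_word_trivial[of k Z X']
    by (auto simp: marked_class_def marked_iso_rel_def)
  have mem: "X \<in> marked_class k X" "Y \<in> marked_class k Y"
    using X Y by (auto simp: marked_class_def marked_iso_rel_def marked_iso_refl)
  have "(\<exists>X'\<in>marked_class k X. \<exists>Y'\<in>marked_class k Y. \<exists>w\<in>carrier (free_group k).
            length w = l \<and> word_trivial X' w \<noteq> word_trivial Y' w) \<longleftrightarrow>
        (\<exists>w\<in>carrier (free_group k). length w = l \<and> word_trivial X w \<noteq> word_trivial Y w)" for l
    using mem triv by meson
  then show ?thesis
    unfolding marked_dist_def marked_class_eq_iff[OF X Y] by simp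
qed

lemma marked_dist_ultrametric:
  assumes "P \<in> marked_space k" "Q \<in> marked_space k" "R \<in> marked_space k"
  shows "marked_dist k P R \<le> max (marked_dist k P Q) (marked_dist k Q R)"
proof -
  obtain X Y Z where X: "marked_group k X" "P = marked_class k X"
    and Y: "marked_group k Y" "Q = marked_class k Y"
    and Z: "marked_group k Z" "R = marked_class k Z"
    using assms by (auto elim!: marked_space_cases)
  define D where "D U V l \<longleftrightarrow> (\<exists>w\<in>carrier (free_group k).
      length w = l \<and> word_trivial U w \<noteq> word_trivial V w)" for U V :: "word set marked" and l
  have dist: "marked_dist k (marked_class k U) (marked_class k V) =
      (if marked_iso U V then 0 else exp (- real (LEAST l. D U V l)))"
    if "marked_group k U" "marked_group k V" for U V
    using marked_dist_class[OF that] by (simp add: D_def)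
  have ge: "exp (- real l) \<le> marked_dist k (marked_class k U) (marked_class k V)"
    if "marked_group k U" "marked_group k V" "D U V l" for U V l
  proof -
    have "\<not> marked_iso U V"
      using that marked_iso_iff_word_trivial[of k U V] by (auto simp: D_def)
    then show ?thesis
      using dist[OF that(1,2)] Least_le[of "D U V" l, OF that(3)] by simp
  qed
  show ?thesis
  proof (cases "marked_iso X Z")
    case True
    then show ?thesis
      by (simp add: X(2) Z(2) dist[OF X(1) Z(1)] le_max_iff_disj) (simp add: marked_dist_def)
  next
    case False
    define l where "l = (LEAST l. D X Z l)"
    have "\<exists>l. D X Z l"
      using False marked_iso_iff_word_trivial[OF X(1) Z(1)] by (auto simp: D_def)
    then have "D X Z l"
      unfolding l_def by (rule LeastI_ex)
    then have "D X Y l \<or> D Y Z l"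
      by (auto simp: D_def)
    then have "exp (- real l) \<le> max (marked_dist k P Q) (marked_dist k Q R)"
      using ge[OF X(1) Y(1)] ge[OF Y(1) Z(1)] X(2) Y(2) Z(2) by (auto simp: le_max_iff_disj)
    then show ?thesis
      using False by (simp add: X(2) Z(2) dist[OF X(1) Z(1)] l_def)
  qed
qed

theorem Metric_space_marked: "Metric_space (marked_space k) (marked_dist k)"
proof
  fix P Q :: "word set marked set"
  show "0 \<le> marked_dist k P Q"
    by (simp add: marked_dist_def)
  have "(\<exists>X\<in>P. \<exists>Y\<in>Q. \<exists>w\<in>carrier (free_group k).
            length w = l \<and> word_trivial X w \<noteq> word_trivial Y w) \<longleftrightarrow>
        (\<exists>X\<in>Q. \<exists>Y\<in>P. \<exists>w\<in>carrier (free_group k).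
            length w = l \<and> word_trivial X w \<noteq> word_trivial Y w)" for l
    by metis
  then show "marked_dist k P Q = marked_dist k Q P"
    by (auto simp: marked_dist_def)
  show "marked_dist k P Q = 0 \<longleftrightarrow> P = Q"
    by (simp add: marked_dist_def)
next
  fix P Q R assume "P \<in> marked_space k" "Q \<in> marked_space k" "R \<in> marked_space k"
  then have "marked_dist k P R \<le> max (marked_dist k P Q) (marked_dist k Q R)"
    by (rule marked_dist_ultrametric)
  also have "\<dots> \<le> marked_dist k P Q + marked_dist k Q R"
    by (simp add: marked_dist_def)
  finally show "marked_dist k P R \<le> marked_dist k P Q + marked_dist k Q R" .
qed

lemma BS_relator_closed: "BS_relator m n \<in> carrier (free_group 2)"
proof -
  interpret group "free_group 2" by (rule group_free_group)
  have "free_gen 0 \<in> carrier (free_group 2)" "free_gen 1 \<in> carrier (free_group 2)"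
    by (simp_all add: free_gen_closed)
  then show ?thesis
    unfolding BS_relator_def Let_def by simp
qed

lemma BS_in_marked_space: "BS m n \<in> marked_space 2"
  unfolding BS_def
  by (intro marked_class_in_space marked_group_presented) (simp add: BS_relator_closed)

end

theory Submission
  imports Defs
begin

text \<open>
  A sequence of marked groups converges if and only if, for every word, triviality of the word is
  eventually constant along the sequence (\<open>convergent_marked_iff\<close>). So the theorem is about the word
  problem of \<open>BS(m, k)\<close> for varying \<open>k\<close>.

  \<open>BS(m, n)\<close> is an HNN extension of the infinite cyclic group generated by \<open>b\<close>, with stable letter
  \<open>a\<close>. One solves its word problem by reading a word from the right and replacing each pinch
  \<open>a b\<^bsup>mq\<^esup> a\<^bsup>-1\<^esup>\<close> by \<open>b\<^bsup>nq\<^esup>\<close> and each pinch \<open>a\<^bsup>-1\<^esup> b\<^bsup>nq\<^esup> a\<close> by \<open>b\<^bsup>mq\<^esup>\<close> as soon as it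
  appears; the word is trivial exactly if nothing is left (\<open>word_trivial_iff_stack\<close>). That nonempty
  results are nontrivial is Britton's lemma, which follows from the action of the group on normal
  forms (\<open>trivial_imp_act\<close>, \<open>normal_form_of_eq_Tail\<close>).

  That (b) is sufficient: let \<open>k\<close> run through a sequence that satisfies (b). Then the exponents
  that occur in this algorithm are eventually of the form \<open>P(k) / m\<^bsup>N\<^esup>\<close> with a fixed integer polynomial
  \<open>P\<close>. Whether \<open>m\<close> divides such an exponent depends on \<open>k\<close> modulo \<open>m\<^bsup>N + 1\<^esup>\<close>; whether \<open>k\<close>
  divides it depends, as \<open>k\<close> is coprime to \<open>m\<close>, on whether \<open>k\<close> divides \<open>P(0)\<close>, which for large
  \<open>k\<close> means \<open>P(0) = 0\<close>. Hence the algorithm eventually takes the same branches for all members of the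
  sequence, and the final question whether the last exponent is zero is eventually decided as well,
  because \<open>P\<close> is zero or has finitely many roots (\<open>eventually_decided_word_trivial\<close>).

  That (a) or (b) is necessary follows from two families of test words. The word
  \<open>a b\<^bsup>m\<^esup> a\<^bsup>-1\<^esup> b\<^bsup>-c\<^esup>\<close> is trivial in \<open>BS(m, k)\<close> only for \<open>k = c\<close> (\<open>relator_trivial_iff\<close>), so along a
  convergent sequence \<open>k\<close> is eventually constant or its absolute value tends to infinity. If \<open>k\<close> is
  not a unit, then the commutator of \<open>a\<^bsup>h\<^esup> (a b\<^bsup>m\<^esup> a\<^bsup>-1\<^esup> b\<^bsup>-r\<^esup>) a\<^bsup>-h\<^esup>\<close> with \<open>b\<close> is
  trivial exactly if \<open>k\<close> is congruent to \<open>r\<close> modulo \<open>m\<^bsup>h\<^esup>\<close> (\<open>residue_test_trivial_iff\<close>), so in the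
  second case the residues are eventually constant.
\<close>

section \<open>Convergence of marked groups\<close>

lemma word_eval_free_quotient:
  assumes "N \<lhd> free_group k" "w \<in> carrier (free_group k)"
  shows "word_eval (free_quotient k N) w = N #>\<^bsub>free_group k\<^esub> w"
  using assms(2)
proof (induction w)
  interpret N: normal N "free_group k" by fact
  interpret h: group_hom "free_group k" "free_group k Mod N" "\<lambda>a. N #>\<^bsub>free_group k\<^esub> a"
    by (simp add: group_hom_def group_hom_axioms_def group_free_group N.factorgroup_is_group
        N.r_coset_hom_Mod)
  case Nil
  have "\<one>\<^bsub>free_group k\<^esub> = []"
    by (simp add: free_group_def)
  then show ?case
    using h.hom_one by (simp add: free_quotient_def)
next
  interpret N: normal N "free_group k" by fact
  interpret h: group_hom "free_group k" "free_group k Mod N" "\<lambda>a. N #>\<^bsub>free_group k\<^esub> a"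
    by (simp add: group_hom_def group_hom_axioms_def group_free_group N.factorgroup_is_group
        N.r_coset_hom_Mod)
  case (Cons x w)
  obtain i e where x: "x = (i, e)" by fastforce
  have i: "i < k" and w: "w \<in> carrier (free_group k)" and red: "reduced (x # w)"
    using Cons.prems x by (auto simp: free_group_def reduced_Cons)
  define g where "g = (if e then free_gen i else inv\<^bsub>free_group k\<^esub> free_gen i)"
  have "g \<in> carrier (free_group k)"
    using i by (simp add: g_def free_gen_closed)
  moreover have "g = [x]"
    using i by (simp add: g_def x free_gen_inv) (simp add: free_gen_def)
  moreover have "[x] \<otimes>\<^bsub>free_group k\<^esub> w = x # w"
    using reduce_reduced[OF red] by (simp add: free_group_def)
  ultimately have "N #>\<^bsub>free_group k\<^esub> (x # w) =
      (N #>\<^bsub>free_group k\<^esub> g) \<otimes>\<^bsub>free_group k Mod N\<^esub> (N #>\<^bsub>free_group k\<^esub> w)"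
    using h.hom_mult[of g w] w by simp
  then show ?case
    using Cons.IH[OF w] i x by (simp add: g_def free_quotient_def free_gen_closed)
qed

lemma word_trivial_free_quotient:
  assumes "N \<lhd> free_group k" "w \<in> carrier (free_group k)"
  shows "word_trivial (free_quotient k N) w \<longleftrightarrow> w \<in> N"
proof -
  interpret N: normal N "free_group k" by fact
  have "word_trivial (free_quotient k N) w \<longleftrightarrow> N #>\<^bsub>free_group k\<^esub> w = N"
    using word_eval_free_quotient[OF assms]
    by (simp add: word_trivial_def free_quotient_def FactGroup_def)
  then show ?thesis
    using N.coset_join1[of N w] N.coset_join2[of w N] assms N.subgroup_axioms N.subset by blast
qed

lemma eventually_trivial_normal:
  assumes X: "\<And>j. marked_group k (X j)"
  shows "{w \<in> carrier (free_group k). eventually (\<lambda>j. word_trivial (X j) w) F} \<lhd> free_group k"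
    (is "?N \<lhd> _")
proof -
  interpret F: group "free_group k" by (rule group_free_group)
  have h: "group_hom (free_group k) (fst (X j)) (word_eval (X j))" for j
    by (rule group_hom_word_eval[OF X])
  have K: "kernel (free_group k) (fst (X j)) (word_eval (X j)) \<lhd> free_group k" for j
    by (rule group_hom.normal_kernel[OF h])
  have triv: "word_trivial (X j) w \<longleftrightarrow> w \<in> kernel (free_group k) (fst (X j)) (word_eval (X j))"
    if "w \<in> carrier (free_group k)" for j w
    using that by (auto simp: kernel_def word_trivial_def)
  have S: "subgroup (kernel (free_group k) (fst (X j)) (word_eval (X j))) (free_group k)" for j
    using K normal_imp_subgroup by blast
  show ?thesis
  proof (rule F.normal_invI)
    show "subgroup ?N (free_group k)"
    proof (rule F.subgroupI)
      have "\<one>\<^bsub>free_group k\<^esub> \<in> ?N"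
        using triv subgroup.one_closed[OF S] by simp
      then show "?N \<noteq> {}" by blast
    next
      fix u assume "u \<in> ?N"
      then show "inv\<^bsub>free_group k\<^esub> u \<in> ?N"
        by (auto simp: triv intro: subgroup.m_inv_closed[OF S] elim!: eventually_mono)
    next
      fix u v assume "u \<in> ?N" "v \<in> ?N"
      then have "eventually (\<lambda>j. word_trivial (X j) u \<and> word_trivial (X j) v) F"
        by (simp add: eventually_conj)
      with \<open>u \<in> ?N\<close> \<open>v \<in> ?N\<close> show "u \<otimes>\<^bsub>free_group k\<^esub> v \<in> ?N"
        by (auto simp: triv intro: subgroup.m_closed[OF S] elim!: eventually_mono)
    qed auto
  next
    fix g u assume g: "g \<in> carrier (free_group k)" and u: "u \<in> ?N"
    then show "g \<otimes>\<^bsub>free_group k\<^esub> u \<otimes>\<^bsub>free_group k\<^esub> inv\<^bsub>free_group k\<^esub> g \<in> ?N"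
      by (auto simp: triv intro: normal.inv_op_closed2[OF K] elim!: eventually_mono)
  qed
qed

lemma finite_free_group_length: "finite {w \<in> carrier (free_group k). length w \<le> l}"
proof (rule finite_subset)
  show "{w \<in> carrier (free_group k). length w \<le> l} \<subseteq>
      {w. set w \<subseteq> {..<k} \<times> UNIV \<and> length w \<le> l}"
    by (auto simp: free_group_def)
  show "finite {w. set w \<subseteq> {..<k} \<times> (UNIV :: bool set) \<and> length w \<le> l}"
    by (rule finite_lists_length_le) simp
qed

definition eventually_decided :: "(nat \<Rightarrow> bool) \<Rightarrow> bool" where
  "eventually_decided P \<longleftrightarrow>
    (\<forall>\<^sub>F j in sequentially. P j) \<or> (\<forall>\<^sub>F j in sequentially. \<not> P j)"

lemma eventually_decided_const: "eventually_decided (\<lambda>j. v)"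
  by (cases v) (simp_all add: eventually_decided_def)

lemma eventually_decided_cong:
  assumes "\<forall>\<^sub>F j in sequentially. P j \<longleftrightarrow> Q j"
  shows "eventually_decided P \<longleftrightarrow> eventually_decided Q"
proof -
  have neg: "\<forall>\<^sub>F j in sequentially. (\<not> P j) \<longleftrightarrow> (\<not> Q j)"
    using assms by eventually_elim simp
  show ?thesis
    by (simp only: eventually_decided_def eventually_subst[OF assms] eventually_subst[OF neg])
qed

text \<open>A ball of radius about \<open>exp (- l)\<close> around a marked group prescribes which of the
  finitely many reduced words of length at most \<open>l\<close> are trivial. So convergence means that the
  triviality of each word is eventually constant, and the limit is then the free group modulo the
  words that are eventually trivial.\<close>

theorem convergent_marked_iff:
  assumes X: "\<And>j. marked_group k (X j)"
  shows "(\<exists>L. limitin (marked_topology k) (\<lambda>j. marked_class k (X j)) L sequentially) \<longleftrightarrow>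
    (\<forall>w\<in>carrier (free_group k). eventually_decided (\<lambda>j. word_trivial (X j) w))"
    (is "?conv \<longleftrightarrow> ?stable")
proof
  interpret M: Metric_space "marked_space k" "marked_dist k" by (rule Metric_space_marked)
  define D where "D Y Z l \<longleftrightarrow> (\<exists>w\<in>carrier (free_group k).
      length w = l \<and> word_trivial Y w \<noteq> word_trivial Z w)" for Y Z :: "word set marked" and l
  have dist: "marked_dist k (marked_class k Y) (marked_class k Z) =
      (if marked_iso Y Z then 0 else exp (- real (LEAST l. D Y Z l)))"
    if "marked_group k Y" "marked_group k Z" for Y Z
    using marked_dist_class[OF that] by (simp add: D_def)
  {
    assume ?conv
    then obtain L where L: "limitin M.mtopology (\<lambda>j. marked_class k (X j)) L sequentially"
      by (auto simp: marked_topology_def)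
    then have "L \<in> marked_space k"
      by (simp add: M.limitin_metric)
    then obtain Y where Y: "marked_group k Y" "L = marked_class k Y"
      by (rule marked_space_cases)
    show ?stable
    proof
      fix w assume w: "w \<in> carrier (free_group k)"
      have "\<forall>\<^sub>F j in sequentially.
          marked_dist k (marked_class k (X j)) L < exp (- real (length w))"
        using L by (auto simp: M.limitin_metric elim!: allE[of _ "exp (- real (length w))"]
            eventually_mono)
      then have "\<forall>\<^sub>F j in sequentially. word_trivial (X j) w = word_trivial Y w"
      proof (rule eventually_mono)
        fix j assume less: "marked_dist k (marked_class k (X j)) L < exp (- real (length w))"
        show "word_trivial (X j) w = word_trivial Y w"
        proof (rule ccontr)
          assume "word_trivial (X j) w \<noteq> word_trivial Y w"
          then have D: "D (X j) Y (length w)" and "\<not> marked_iso (X j) Y"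
            using w marked_iso_iff_word_trivial[OF X Y(1)] by (auto simp: D_def)
          then show False
            using less Least_le[of "D (X j) Y", OF D] by (simp add: Y(2) dist[OF X Y(1)])
        qed
      qed
      then show "eventually_decided (\<lambda>j. word_trivial (X j) w)"
        by (simp add: eventually_decided_cong eventually_decided_const)
    qed
  next
    assume stable: ?stable
    define N where "N = {w \<in> carrier (free_group k). \<forall>\<^sub>F j in sequentially. word_trivial (X j) w}"
    define Y where "Y = free_quotient k N"
    have N: "N \<lhd> free_group k"
      unfolding N_def by (rule eventually_trivial_normal[OF X])
    have Y: "marked_group k Y"
      unfolding Y_def by (rule marked_group_free_quotient[OF N])
    have ev: "\<forall>\<^sub>F j in sequentially. word_trivial (X j) w = word_trivial Y w"
      if "w \<in> carrier (free_group k)" for w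
    proof (cases "w \<in> N")
      case True
      then show ?thesis
        using word_trivial_free_quotient[OF N that] by (simp add: Y_def N_def)
    next
      case False
      then have "\<forall>\<^sub>F j in sequentially. \<not> word_trivial (X j) w"
        using stable that by (auto simp: N_def eventually_decided_def)
      then show ?thesis
        using word_trivial_free_quotient[OF N that] False by (simp add: Y_def)
    qed
    have "\<forall>\<^sub>F j in sequentially. marked_class k (X j) \<in> marked_space k \<and>
        marked_dist k (marked_class k (X j)) (marked_class k Y) < \<epsilon>" if "\<epsilon> > 0" for \<epsilon>
    proof -
      obtain l :: nat where "- ln \<epsilon> < real l"
        using reals_Archimedean2 by blast
      then have l: "exp (- real l) < \<epsilon>"
        using that by (metis exp_less_mono exp_ln minus_less_iff)
      have "\<forall>\<^sub>F j in sequentially. \<forall>w\<in>{w \<in> carrier (free_group k). length w \<le> l}.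
          word_trivial (X j) w = word_trivial Y w"
        by (rule eventually_ball_finite[OF finite_free_group_length]) (simp add: ev)
      then show ?thesis
      proof (rule eventually_mono)
        fix j assume *: "\<forall>w\<in>{w \<in> carrier (free_group k). length w \<le> l}.
          word_trivial (X j) w = word_trivial Y w"
        have "marked_dist k (marked_class k (X j)) (marked_class k Y) \<le> exp (- real l)"
        proof (cases "marked_iso (X j) Y")
          case False
          then have "\<exists>i. D (X j) Y i"
            using marked_iso_iff_word_trivial[OF X Y] by (auto simp: D_def)
          then have "D (X j) Y (LEAST i. D (X j) Y i)"
            by (rule LeastI_ex)
          then have "l \<le> (LEAST i. D (X j) Y i)"
            using * by (force simp: D_def)
          then show ?thesis
            using False by (simp add: dist[OF X Y])
        qed (simp add: dist[OF X Y])
        then show "marked_class k (X j) \<in> marked_space k \<and>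
            marked_dist k (marked_class k (X j)) (marked_class k Y) < \<epsilon>"
          using l marked_class_in_space[OF X] by simp
      qed
    qed
    then have "limitin M.mtopology (\<lambda>j. marked_class k (X j)) (marked_class k Y) sequentially"
      using marked_class_in_space[OF Y] by (simp add: M.limitin_metric)
    then show ?conv
      by (auto simp: marked_topology_def)
  }
qed

section \<open>Normal forms in Baumslag-Solitar groups\<close>

lemma foldr_action_reduce:
  assumes inv: "\<And>x s. fst x < k \<Longrightarrow> s \<in> S \<Longrightarrow> A x s \<in> S"
    and cancel: "\<And>x s. fst x < k \<Longrightarrow> s \<in> S \<Longrightarrow> A x (A (letter_inv x) s) = s"
    and "fst ` set w \<subseteq> {..<k}" "s \<in> S"
  shows "foldr A (reduce w) s = foldr A w s"
  using assms(3)
proof (induction w)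
  case (Cons x w)
  have stable: "foldr A v s \<in> S" if "fst ` set v \<subseteq> {..<k}" for v
    using that by (induction v) (auto simp: inv \<open>s \<in> S\<close>)
  have red: "fst ` set (reduce w) \<subseteq> {..<k}"
    using set_reduce[of w] Cons.prems by auto
  have "foldr A (red_cons x v) s = A x (foldr A v s)" if v: "fst ` set v \<subseteq> {..<k}" for v
  proof (cases v)
    case (Cons y u)
    have "A x (A (letter_inv x) (foldr A u s)) = foldr A u s"
      using Cons v \<open>fst ` set (x # w) \<subseteq> {..<k}\<close> by (intro cancel stable) auto
    then show ?thesis
      using Cons by simp
  qed simp
  then show ?case
    using Cons red by (simp add: reduce_def)
qed (simp add: reduce_def)

text \<open>To see that an element of a presented group is nontrivial it suffices to let the
  generators act by permutations so that the relators act trivially: the words that act trivially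
  form a normal subgroup, which then contains the normal closure of the relators.\<close>

lemma kernel_of_action_normal:
  assumes inv: "\<And>x s. fst x < k \<Longrightarrow> s \<in> S \<Longrightarrow> A x s \<in> S"
    and cancel: "\<And>x s. fst x < k \<Longrightarrow> s \<in> S \<Longrightarrow> A x (A (letter_inv x) s) = s"
  shows "{w \<in> carrier (free_group k). \<forall>s\<in>S. foldr A w s = s} \<lhd> free_group k" (is "?N \<lhd> _")
proof -
  interpret F: group "free_group k" by (rule group_free_group)
  have stable: "foldr A w s \<in> S" if "w \<in> carrier (free_group k)" "s \<in> S" for w s
    using that by (induction w) (auto simp: inv free_group_def reduced_Cons)
  have mult: "foldr A (u \<otimes>\<^bsub>free_group k\<^esub> v) s = foldr A u (foldr A v s)"
    if "u \<in> carrier (free_group k)" "v \<in> carrier (free_group k)" "s \<in> S" for u v s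
  proof -
    have "foldr A (reduce (u @ v)) s = foldr A (u @ v) s"
      by (rule foldr_action_reduce[where k = k and S = S])
        (use that inv cancel in \<open>auto simp: free_group_def\<close>)
    then show ?thesis
      by (simp add: free_group_def)
  qed
  have one: "foldr A \<one>\<^bsub>free_group k\<^esub> s = s" for s
    by (simp add: free_group_def)
  show ?thesis
  proof (rule F.normal_invI)
    show "subgroup ?N (free_group k)"
    proof (rule F.subgroupI)
      have "\<one>\<^bsub>free_group k\<^esub> \<in> ?N"
        using one by simp
      then show "?N \<noteq> {}" by blast
    next
      fix u assume u: "u \<in> ?N"
      then have "foldr A (inv\<^bsub>free_group k\<^esub> u) s = s" if "s \<in> S" for s
        using mult[of "inv\<^bsub>free_group k\<^esub> u" u s] one that by auto
      then show "inv\<^bsub>free_group k\<^esub> u \<in> ?N"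
        using u by auto
    qed (auto simp: mult)
  next
    fix g u assume g: "g \<in> carrier (free_group k)" and u: "u \<in> ?N"
    have "foldr A (g \<otimes>\<^bsub>free_group k\<^esub> u \<otimes>\<^bsub>free_group k\<^esub> inv\<^bsub>free_group k\<^esub> g) s = s" if "s \<in> S" for s
    proof -
      have "foldr A (g \<otimes>\<^bsub>free_group k\<^esub> u \<otimes>\<^bsub>free_group k\<^esub> inv\<^bsub>free_group k\<^esub> g) s =
          foldr A g (foldr A (inv\<^bsub>free_group k\<^esub> g) s)"
        using g u that by (simp add: mult stable)
      also have "\<dots> = s"
        using mult[of g "inv\<^bsub>free_group k\<^esub> g" s] g that one by simp
      finally show ?thesis .
    qed
    then show "g \<otimes>\<^bsub>free_group k\<^esub> u \<otimes>\<^bsub>free_group k\<^esub> inv\<^bsub>free_group k\<^esub> g \<in> ?N"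
      using g u by auto
  qed
qed

text \<open>\<open>Tail e\<close> stands for \<open>b\<^bsup>e\<^esup>\<close>, and \<open>Syl c s t\<close> for \<open>b\<^bsup>c\<^esup> a t\<close> if \<open>s\<close> holds and for
  \<open>b\<^bsup>c\<^esup> a\<^bsup>-1\<^esup> t\<close> otherwise.\<close>

datatype form = Tail int | Syl int bool form

locale baumslag_solitar =
  fixes m n :: int
  assumes m_nonzero: "m \<noteq> 0" and n_nonzero: "n \<noteq> 0"
begin

text \<open>The defining relation reads
  \<open>b\<^bsup>edge s\<^esup> a\<^bsup>s\<^esup> = a\<^bsup>s\<^esup> b\<^bsup>edge (\<not> s)\<^esup>\<close>, where \<open>a\<^bsup>s\<^esup>\<close> is \<open>a\<close> for
  \<open>s = True\<close> and its inverse for \<open>s = False\<close>.\<close>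

definition edge :: "bool \<Rightarrow> int" where
  "edge s = (if s then n else m)"

lemma edge_nonzero [simp]: "edge s \<noteq> 0"
  by (simp add: edge_def m_nonzero n_nonzero)

text \<open>Left multiplication of a normal form by \<open>b\<^bsup>x\<^esup>\<close>: the quotient modulo the edge
  exponent moves past the letter \<open>a\<^bsup>s\<^esup>\<close> by the defining relation, and the residue, which is the
  coset representative, stays.\<close>

fun shift :: "int \<Rightarrow> form \<Rightarrow> form" where
  "shift x (Tail e) = Tail (e + x)"
| "shift x (Syl c s t) =
    Syl ((c + x) mod edge s) s (shift (edge (\<not> s) * ((c + x) div edge s)) t)"

text \<open>Left multiplication of a normal form by \<open>a\<^bsup>s\<^esup>\<close>.\<close>

fun cross :: "bool \<Rightarrow> form \<Rightarrow> form" where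
  "cross s (Tail e) = Syl 0 s (Tail e)"
| "cross s (Syl c s' t) = (if c = 0 \<and> s' = (\<not> s) then t else Syl 0 s (Syl c s' t))"

text \<open>Whether a letter \<open>a\<^bsup>s\<^esup>\<close> put in front of the form could be removed by the defining
  relation, that is, whether it would create a pinch.\<close>

fun backtracks :: "bool \<Rightarrow> form \<Rightarrow> bool" where
  "backtracks s (Tail e) \<longleftrightarrow> False"
| "backtracks s (Syl c s' t) \<longleftrightarrow> s' = (\<not> s) \<and> edge s' dvd c"

fun britton_reduced :: "form \<Rightarrow> bool" where
  "britton_reduced (Tail e) \<longleftrightarrow> True"
| "britton_reduced (Syl c s t) \<longleftrightarrow> \<not> backtracks s t \<and> britton_reduced t"

fun transversal :: "form \<Rightarrow> bool" where
  "transversal (Tail e) \<longleftrightarrow> True"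
| "transversal (Syl c s t) \<longleftrightarrow> c mod edge s = c \<and> transversal t"

definition normal_form :: "form \<Rightarrow> bool" where
  "normal_form t \<longleftrightarrow> britton_reduced t \<and> transversal t"

lemma shift_shift: "shift x (shift y t) = shift (x + y) t"
proof (induction t arbitrary: x y)
  case (Syl c s t)
  have "((c + y) mod edge s + x) mod edge s = (c + (x + y)) mod edge s"
    by (simp add: mod_simps algebra_simps)
  moreover have "((c + y) mod edge s + x) div edge s + (c + y) div edge s = (c + (x + y)) div edge s"
  proof -
    have "c + (x + y) = ((c + y) mod edge s + x) + (c + y) div edge s * edge s"
      using div_mult_mod_eq[of "c + y" "edge s"] by linarith
    then show ?thesis
      by (metis div_mult_self1 edge_nonzero add.commute)
  qed
  ultimately show ?case
    by (simp add: Syl.IH flip: distrib_left)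
qed simp

lemma shift_0: "transversal t \<Longrightarrow> shift 0 t = t"
proof (induction t)
  case (Syl c s t)
  then have "c div edge s = 0"
    using div_mult_mod_eq[of c "edge s"] by (simp add: mod_eq_self_iff_div_eq_0)
  then show ?case
    using Syl by simp
qed simp

lemma backtracks_shift: "backtracks s (shift (edge (\<not> s) * q) t) \<longleftrightarrow> backtracks s t"
  by (cases t) (auto simp: dvd_add_left_iff dvd_mod_iff)

lemma normal_form_shift: "normal_form t \<Longrightarrow> normal_form (shift x t)"
  by (induction t arbitrary: x) (auto simp: normal_form_def backtracks_shift)

lemma normal_form_cross: "normal_form t \<Longrightarrow> normal_form (cross s t)"
  by (cases t) (auto simp: normal_form_def dvd_eq_mod_eq_0)

lemma cross_cross: "normal_form t \<Longrightarrow> cross s (cross (\<not> s) t) = t"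
proof (cases t)
  case (Syl c s' t')
  moreover assume "normal_form t"
  ultimately show ?thesis
    by (cases t') (auto simp: normal_form_def)
qed simp

text \<open>Shifting by a multiple of the edge exponent keeps the first residue, so it does not change
  whether \<open>cross\<close> cancels. This is the relation of the group, read in the action.\<close>

lemma cross_shift:
  assumes "normal_form t"
  shows "cross s (shift (edge (\<not> s) * q) t) = shift (edge s * q) (cross s t)"
proof (cases t)
  case (Syl c s' t')
  show ?thesis
  proof (cases "s' = (\<not> s)")
    case True
    define d where "d = edge (\<not> s)"
    have "c mod d = c" "d \<noteq> 0"
      using assms Syl True by (simp_all add: normal_form_def d_def)
    then have "(c + d * q) mod d = c" "(c + d * q) div d = q"
      by (simp_all add: mod_eq_self_iff_div_eq_0)
    then show ?thesis
      by (simp add: Syl True flip: d_def)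
  qed (simp add: Syl)
qed simp

definition move :: "nat \<times> bool \<Rightarrow> form \<Rightarrow> form" where
  "move x = (if fst x = 0 then cross (snd x) else shift (if snd x then 1 else - 1))"

lemma normal_form_move: "normal_form t \<Longrightarrow> normal_form (move x t)"
  by (simp add: move_def normal_form_shift normal_form_cross)

lemma move_cancel: "normal_form t \<Longrightarrow> move x (move (letter_inv x) t) = t"
  using cross_cross[of t "snd x"]
  by (auto simp: move_def letter_inv_def shift_shift shift_0 normal_form_def)

definition act :: "word \<Rightarrow> form \<Rightarrow> form" where
  "act w = foldr move w"

abbreviation (input) "F \<equiv> free_group 2"

lemma normal_form_act: "normal_form t \<Longrightarrow> normal_form (act w t)"
  unfolding act_def by (induction w) (auto simp: normal_form_move)

lemma act_mult:
  assumes "u \<in> carrier F" "v \<in> carrier F" "normal_form t"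
  shows "act (u \<otimes>\<^bsub>F\<^esub> v) t = act u (act v t)"
proof -
  have "act (reduce (u @ v)) t = act (u @ v) t"
    unfolding act_def
    by (rule foldr_action_reduce[where k = 2 and S = "{t. normal_form t}"])
      (use assms in \<open>auto simp: free_group_def normal_form_move move_cancel\<close>)
  then show ?thesis
    by (simp add: free_group_def act_def)
qed

lemma act_one: "act \<one>\<^bsub>F\<^esub> t = t"
  by (simp add: act_def free_group_def)

lemma act_inv_cancel:
  assumes "u \<in> carrier F" "normal_form t"
  shows "act (inv\<^bsub>F\<^esub> u) (act u t) = t"
proof -
  interpret F: group F by (rule group_free_group)
  show ?thesis
    using act_mult[of "inv\<^bsub>F\<^esub> u" u t] assms by (simp add: act_one)
qed

lemma gen_closed [simp]: "free_gen 0 \<in> carrier F" "free_gen 1 \<in> carrier F" "free_gen (Suc 0) \<in> carrier F"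
  by (simp_all add: free_gen_closed)

lemma act_gen_0 [simp]: "act (free_gen 0) t = cross True t"
  "act (inv\<^bsub>F\<^esub> (free_gen 0)) t = cross False t"
  by (simp_all add: act_def free_gen_inv move_def) (simp add: free_gen_def move_def)

lemma act_pow_nat:
  assumes "normal_form t"
  shows "act (free_gen 1 [^]\<^bsub>F\<^esub> (i :: nat)) t = shift (int i) t"
proof -
  interpret F: group F by (rule group_free_group)
  have gen: "act (free_gen 1) t = shift 1 t" for t
    by (simp add: act_def free_gen_def move_def)
  show ?thesis
    using assms
  proof (induction i arbitrary: t)
    case 0
    then show ?case
      using act_one by (simp add: shift_0 normal_form_def)
  next
    case (Suc i)
    then show ?case
      by (simp add: act_mult normal_form_shift shift_shift add.commute gen[unfolded One_nat_def])
  qed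
qed

lemma act_pow:
  assumes "normal_form t"
  shows "act (free_gen 1 [^]\<^bsub>F\<^esub> (x :: int)) t = shift x t"
proof (cases x rule: int_cases2)
  case (nonneg i)
  then show ?thesis
    using act_pow_nat[OF assms, of i] by (simp only: int_pow_int)
next
  case (nonpos i)
  interpret F: group F by (rule group_free_group)
  let ?u = "free_gen 1 [^]\<^bsub>F\<^esub> i"
  have "act (inv\<^bsub>F\<^esub> ?u) (act ?u (shift x t)) = shift x t"
    by (intro act_inv_cancel F.nat_pow_closed gen_closed normal_form_shift assms)
  moreover have "act ?u (shift x t) = t"
    unfolding act_pow_nat[OF normal_form_shift[OF assms]] shift_shift
    using assms by (simp add: nonpos shift_0 normal_form_def)
  ultimately show ?thesis
    unfolding nonpos F.int_pow_neg_int[OF gen_closed(2)] by simp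
qed

lemma act_BS_relator:
  assumes "normal_form t"
  shows "act (BS_relator m c) t = shift (n - c) t"
proof -
  interpret F: group F by (rule group_free_group)
  have "act (inv\<^bsub>F\<^esub> (free_gen 1 [^]\<^bsub>F\<^esub> c)) t = shift (- c) t" if "normal_form t" for t
    using act_pow[OF that, of "- c"] F.int_pow_neg[of "free_gen 1" c] by simp
  moreover have "cross True (shift m t) = shift n (cross True t)" if "normal_form t" for t
    using cross_shift[OF that, of True 1] by (simp add: edge_def)
  ultimately show ?thesis
    using assms cross_cross[of "shift (-c) t" True]
    by (simp add: BS_relator_def Let_def act_mult normal_form_act normal_form_cross
        normal_form_shift act_pow[unfolded One_nat_def] shift_shift)
qed

abbreviation (input) "G \<equiv> presented 2 {BS_relator m n}"

lemma marked_G: "marked_group 2 G"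
  by (intro marked_group_presented) (simp add: BS_relator_closed)

lemma word_trivial_iff_closure:
  assumes "w \<in> carrier F"
  shows "word_trivial G w \<longleftrightarrow> w \<in> normal_closure F {BS_relator m n}"
  unfolding presented_def
  by (intro word_trivial_free_quotient normal_closure_normal group_free_group assms)
    (simp add: BS_relator_closed)

text \<open>By \<open>act_BS_relator\<close> the relator fixes all normal forms, so the group acts on them; this
  is van der Waerden's way of showing that normal forms are unique.\<close>

lemma trivial_imp_act:
  assumes "w \<in> carrier F" "word_trivial G w" "normal_form t"
  shows "act w t = t"
proof -
  let ?N = "{w \<in> carrier F. \<forall>t\<in>{t. normal_form t}. foldr move w t = t}"
  have "?N \<lhd> F"
    by (rule kernel_of_action_normal) (auto simp: normal_form_move move_cancel)
  moreover have "{BS_relator m n} \<subseteq> ?N"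
    using act_BS_relator[of _ n] BS_relator_closed
    by (simp add: act_def shift_0 normal_form_def)
  ultimately have "normal_closure F {BS_relator m n} \<subseteq> ?N"
    unfolding normal_closure_def by blast
  then show ?thesis
    using assms word_trivial_iff_closure by (auto simp: act_def)
qed

end

section \<open>The word problem of Baumslag-Solitar groups\<close>

fun add_head :: "int \<Rightarrow> form \<Rightarrow> form" where
  "add_head x (Tail e) = Tail (e + x)"
| "add_head x (Syl c s t) = Syl (c + x) s t"

context baumslag_solitar
begin

text \<open>Reading a word from the right, \<open>push\<close> removes a pinch as soon as it appears. Unlike in a
  normal form, the exponents are not reduced modulo the edge exponents: a residue modulo a varying
  \<open>n\<close> has no uniform expression in \<open>n\<close>, whereas the exponents on this stack are polynomial in \<open>n\<close>
  up to a denominator, as long as the same pinches are removed.\<close>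

fun push :: "bool \<Rightarrow> form \<Rightarrow> form" where
  "push s (Tail e) = Syl 0 s (Tail e)"
| "push s (Syl c s' t) =
    (if s' = (\<not> s) \<and> edge s' dvd c then add_head (edge s * (c div edge s')) t
     else Syl 0 s (Syl c s' t))"

definition stack_step :: "nat \<times> bool \<Rightarrow> form \<Rightarrow> form" where
  "stack_step x = (if fst x = 0 then push (snd x) else add_head (if snd x then 1 else - 1))"

definition stack :: "word \<Rightarrow> form" where
  "stack w = foldr stack_step w (Tail 0)"

text \<open>The image of \<open>Tail 0\<close> under the element that the form represents.\<close>

fun normal_form_of :: "form \<Rightarrow> form" where
  "normal_form_of (Tail e) = Tail e"
| "normal_form_of (Syl c s t) = shift c (cross s (normal_form_of t))"

lemma normal_form_normal_form_of: "normal_form (normal_form_of t)"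
  by (induction t) (auto simp: normal_form_shift normal_form_cross, simp add: normal_form_def)

lemma normal_form_of_add_head: "normal_form_of (add_head x t) = shift x (normal_form_of t)"
  by (cases t) (auto simp: shift_shift add.commute)

lemma normal_form_of_push: "normal_form_of (push s t) = cross s (normal_form_of t)"
proof (cases "backtracks s t")
  case True
  then obtain q t' where t: "t = Syl (edge (\<not> s) * q) (\<not> s) t'"
    by (cases t) auto
  have "cross s (normal_form_of t) = shift (edge s * q) (cross s (cross (\<not> s) (normal_form_of t')))"
    by (simp add: t cross_shift normal_form_normal_form_of normal_form_cross)
  then show ?thesis
    by (simp add: t normal_form_of_add_head cross_cross normal_form_normal_form_of)
next
  case False
  have "push s t = Syl 0 s t"
    using False by (cases t) auto
  moreover have "transversal (cross s (normal_form_of t))"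
    using normal_form_normal_form_of normal_form_cross normal_form_def by blast
  ultimately show ?thesis
    by (simp add: shift_0)
qed

lemma act_Tail_0: "act w (Tail 0) = normal_form_of (stack w)"
  by (induction w)
    (auto simp: act_def stack_def move_def stack_step_def normal_form_of_push normal_form_of_add_head)

lemma britton_reduced_add_head: "britton_reduced t \<Longrightarrow> britton_reduced (add_head x t)"
  by (cases t) auto

lemma britton_reduced_push: "britton_reduced t \<Longrightarrow> britton_reduced (push s t)"
  by (cases t) (auto simp: britton_reduced_add_head)

lemma britton_reduced_stack: "britton_reduced (stack w)"
  by (induction w) (auto simp: stack_def stack_step_def britton_reduced_push britton_reduced_add_head)

lemma normal_form_of_head:
  assumes "britton_reduced (Syl c s t)"
  shows "\<exists>t'. normal_form_of (Syl c s t) = Syl (c mod edge s) s t'"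
  using assms
proof (induction t arbitrary: c s)
  case (Syl d s' t)
  then obtain t' where t': "normal_form_of (Syl d s' t) = Syl (d mod edge s') s' t'"
    by (metis britton_reduced.simps(2))
  then have "cross s (normal_form_of (Syl d s' t)) = Syl 0 s (normal_form_of (Syl d s' t))"
    using Syl.prems by (auto simp: dvd_eq_mod_eq_0)
  then show ?case
    by (metis normal_form_of.simps(2) shift.simps(2) add_0)
qed simp

text \<open>Britton's lemma: a form without pinches that contains the stable letter does not lie in the
  subgroup generated by \<open>b\<close>, because normalisation keeps its first syllable up to a residue.\<close>

lemma normal_form_of_eq_Tail:
  assumes "britton_reduced t" "normal_form_of t = Tail e"
  shows "t = Tail e"
  using assms normal_form_of_head by (cases t) fastforce+

end

lemma eval_BS_relator:
  assumes "marked_group 2 X"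
  shows "word_eval X (BS_relator m c) = snd X ! 0 \<otimes>\<^bsub>fst X\<^esub> (snd X ! Suc 0) [^]\<^bsub>fst X\<^esub> m
    \<otimes>\<^bsub>fst X\<^esub> inv\<^bsub>fst X\<^esub> (snd X ! 0) \<otimes>\<^bsub>fst X\<^esub> inv\<^bsub>fst X\<^esub> ((snd X ! Suc 0) [^]\<^bsub>fst X\<^esub> c)"
proof -
  interpret \<pi>: group_hom "free_group 2" "fst X" "word_eval X"
    by (rule group_hom_word_eval[OF assms])
  show ?thesis
    using word_eval_gen[OF assms, of 0] word_eval_gen[OF assms, of 1]
    by (simp add: BS_relator_def Let_def \<pi>.hom_int_pow free_gen_closed)
qed

text \<open>That the stack keeps representing the same element needs nothing but the defining relation,
  so it is checked in an arbitrary group with two elements that satisfy it.\<close>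

locale baumslag_solitar_relation = group G + baumslag_solitar m n
  for G :: "('a, 'b) monoid_scheme" (structure) and m n :: int +
  fixes a b
  assumes a_closed [simp]: "a \<in> carrier G" and b_closed [simp]: "b \<in> carrier G"
    and relation: "a \<otimes> b [^] m \<otimes> inv a = b [^] n"
begin

lemma conjugate_power: "a \<otimes> b [^] (m * q) = b [^] (n * q) \<otimes> a"
proof -
  let ?c = "\<lambda>x. a \<otimes> x \<otimes> inv a"
  have "a \<otimes> (x \<otimes> y) \<otimes> inv a = ?c x \<otimes> ?c y" if "x \<in> carrier G" "y \<in> carrier G" for x y
    using that by (simp add: m_assoc inv_solve_left)
  then have "?c \<in> hom G G"
    by (auto intro!: homI)
  then have "?c ((b [^] m) [^] q) = ?c (b [^] m) [^] q"
    by (intro hom_int_pow is_group) auto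
  then have "a \<otimes> b [^] (m * q) \<otimes> inv a = b [^] (n * q)"
    by (simp add: relation int_pow_pow)
  then show ?thesis
    by (metis a_closed b_closed int_pow_closed inv_solve_right' m_closed)
qed

definition stable_letter :: "bool \<Rightarrow> 'a" where
  "stable_letter s = (if s then a else inv a)"

lemma stable_letter_closed [simp]: "stable_letter s \<in> carrier G"
  by (simp add: stable_letter_def)

lemma stable_letter_inverse: "stable_letter s \<otimes> stable_letter (\<not> s) = \<one>"
  by (simp add: stable_letter_def)

lemma stable_letter_power:
  "stable_letter s \<otimes> b [^] (edge (\<not> s) * q) = b [^] (edge s * q) \<otimes> stable_letter s"
proof (cases s)
  case True
  then show ?thesis
    using conjugate_power[of q] by (simp add: edge_def stable_letter_def)
next
  case False
  have "inv a \<otimes> (a \<otimes> b [^] (m * q)) \<otimes> inv a = inv a \<otimes> (b [^] (n * q) \<otimes> a) \<otimes> inv a"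
    by (simp only: conjugate_power)
  moreover have "inv a \<otimes> (a \<otimes> b [^] (m * q)) = b [^] (m * q)"
    by (simp flip: m_assoc)
  moreover have "inv a \<otimes> (b [^] (n * q) \<otimes> a) \<otimes> inv a = inv a \<otimes> b [^] (n * q)"
    by (simp add: m_assoc)
  ultimately show ?thesis
    using False by (simp add: edge_def stable_letter_def)
qed

fun form_value :: "form \<Rightarrow> 'a" where
  "form_value (Tail e) = b [^] e"
| "form_value (Syl c s t) = b [^] c \<otimes> (stable_letter s \<otimes> form_value t)"

lemma form_value_closed [simp]: "form_value t \<in> carrier G"
  by (induction t) simp_all

lemma form_value_add_head: "form_value (add_head x t) = b [^] x \<otimes> form_value t"
  by (cases t) (simp_all add: add.commute[of _ x] int_pow_mult m_assoc)

lemma form_value_push: "form_value (push s t) = stable_letter s \<otimes> form_value t"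
proof (cases "backtracks s t")
  case True
  then obtain q t' where t: "t = Syl (edge (\<not> s) * q) (\<not> s) t'"
    by (cases t) auto
  have "stable_letter s \<otimes> form_value t =
      (stable_letter s \<otimes> b [^] (edge (\<not> s) * q)) \<otimes> (stable_letter (\<not> s) \<otimes> form_value t')"
    by (simp add: t m_assoc)
  also have "\<dots> = b [^] (edge s * q) \<otimes> ((stable_letter s \<otimes> stable_letter (\<not> s)) \<otimes> form_value t')"
    unfolding stable_letter_power by (simp add: m_assoc)
  finally show ?thesis
    by (simp add: t form_value_add_head stable_letter_inverse)
next
  case False
  then have "push s t = Syl 0 s t"
    by (cases t) auto
  then show ?thesis
    by simp
qed

lemma conjugate_iterated:
  "a [^] h \<otimes> b [^] (m ^ h * q) = b [^] (n ^ h * q) \<otimes> a [^] (h :: nat)"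
proof (induction h arbitrary: q)
  case (Suc h)
  have "a [^] Suc h \<otimes> b [^] (m ^ Suc h * q) = a [^] h \<otimes> (a \<otimes> b [^] (m * (m ^ h * q)))"
    by (simp add: m_assoc mult.assoc)
  also have "\<dots> = a [^] h \<otimes> b [^] (m ^ h * (n * q)) \<otimes> a"
    unfolding conjugate_power by (simp add: m_assoc mult.left_commute)
  also have "\<dots> = b [^] (n ^ Suc h * q) \<otimes> a [^] Suc h"
    unfolding Suc by (simp add: m_assoc mult.assoc mult.left_commute)
  finally show ?case .
qed simp

end

context baumslag_solitar
begin

abbreviation (input) "A \<equiv> snd G ! 0"
abbreviation (input) "B \<equiv> snd G ! Suc 0"

lemma relation_G: "baumslag_solitar_relation (fst G) m n A B"
proof -
  interpret G: group "fst G"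
    using marked_G by (simp add: marked_group_def)
  have AB: "A \<in> carrier (fst G)" "B \<in> carrier (fst G)"
    using marked_G by (auto simp: marked_group_def)
  have "BS_relator m n \<in> normal_closure F {BS_relator m n}"
    by (auto simp: normal_closure_def)
  then have "word_eval G (BS_relator m n) = \<one>\<^bsub>fst G\<^esub>"
    using word_trivial_iff_closure[OF BS_relator_closed] by (simp add: word_trivial_def)
  then have "A \<otimes>\<^bsub>fst G\<^esub> B [^]\<^bsub>fst G\<^esub> m \<otimes>\<^bsub>fst G\<^esub> inv\<^bsub>fst G\<^esub> A = B [^]\<^bsub>fst G\<^esub> n"
    unfolding eval_BS_relator[OF marked_G]
    by (metis AB G.int_pow_closed G.inv_closed G.inv_solve_right G.l_one G.m_closed G.one_closed)
  then show ?thesis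
    using AB by unfold_locales
qed

sublocale G: baumslag_solitar_relation "fst (presented 2 {BS_relator m n})" m n
  "snd (presented 2 {BS_relator m n}) ! 0" "snd (presented 2 {BS_relator m n}) ! Suc 0"
  by (rule relation_G)

lemma eval_eq_form_value:
  assumes "fst ` set w \<subseteq> {..<2}"
  shows "word_eval G w = G.form_value (stack w)"
  using assms
proof (induction w)
  case (Cons x w)
  obtain i e where x: "x = (i, e)" by fastforce
  then have "i = 0 \<or> i = 1"
    using Cons.prems by auto
  moreover have "stack (x # w) = stack_step x (stack w)"
    by (simp add: stack_def)
  ultimately show ?case
    using Cons x G.int_pow_neg[OF G.b_closed, of 1] G.int_pow_1[OF G.b_closed]
    by (auto simp: stack_step_def G.form_value_push G.form_value_add_head G.stable_letter_def)
qed (simp add: stack_def)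

text \<open>The solution of the word problem. The stack represents the same element as the word, which
  gives one direction. Conversely, a trivial word fixes the normal form \<open>Tail 0\<close>; its stack has no
  pinches, so by Britton's lemma it is \<open>Tail 0\<close> itself.\<close>

theorem word_trivial_iff_stack:
  assumes "w \<in> carrier F"
  shows "word_trivial G w \<longleftrightarrow> stack w = Tail 0"
proof
  assume "word_trivial G w"
  then have "act w (Tail 0) = Tail 0"
    by (intro trivial_imp_act assms) (auto simp: normal_form_def)
  then have "normal_form_of (stack w) = Tail 0"
    by (simp add: act_Tail_0)
  then show "stack w = Tail 0"
    using normal_form_of_eq_Tail britton_reduced_stack by blast
next
  assume "stack w = Tail 0"
  then show "word_trivial G w"
    using assms eval_eq_form_value[of w] by (simp add: word_trivial_def free_group_def)
qed

lemma relator_trivial_iff: "word_trivial G (BS_relator m c) \<longleftrightarrow> n = c"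
proof
  assume "word_trivial G (BS_relator m c)"
  then have "act (BS_relator m c) (Tail 0) = Tail 0"
    by (intro trivial_imp_act BS_relator_closed) (auto simp: normal_form_def)
  then show "n = c"
    by (simp add: act_BS_relator normal_form_def)
next
  assume "n = c"
  then have "word_eval G (BS_relator m c) = \<one>\<^bsub>fst G\<^esub>"
    using G.r_inv[OF G.int_pow_closed[OF G.b_closed], of n]
    unfolding eval_BS_relator[OF marked_G] G.relation by simp
  then show "word_trivial G (BS_relator m c)"
    by (simp add: word_trivial_def)
qed

end

section \<open>Words that detect the parameter\<close>

definition conjugated_relator :: "int \<Rightarrow> int \<Rightarrow> nat \<Rightarrow> word" where
  "conjugated_relator m r h =
    (let F = free_group 2; a = free_gen 0
     in (a [^]\<^bsub>F\<^esub> h) \<otimes>\<^bsub>F\<^esub> BS_relator m r \<otimes>\<^bsub>F\<^esub> inv\<^bsub>F\<^esub> (a [^]\<^bsub>F\<^esub> h))"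

text \<open>In \<open>BS m n\<close> the inner factor of the conjugated relator equals \<open>b\<^bsup>n - r\<^esup>\<close>, and
  for \<open>n\<close> coprime to \<open>m\<close>, conjugation by \<open>a\<^bsup>h\<^esup>\<close> keeps it among the powers of \<open>b\<close> exactly if
  \<open>m\<^bsup>h\<^esup>\<close> divides \<open>n - r\<close>. If \<open>n\<close> is not a unit, the commutator with \<open>b\<close> detects this.\<close>

definition residue_test :: "int \<Rightarrow> int \<Rightarrow> nat \<Rightarrow> word" where
  "residue_test m r h =
    (let F = free_group 2; u = conjugated_relator m r h; b = free_gen 1
     in u \<otimes>\<^bsub>F\<^esub> b \<otimes>\<^bsub>F\<^esub> inv\<^bsub>F\<^esub> u \<otimes>\<^bsub>F\<^esub> inv\<^bsub>F\<^esub> b)"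

lemma conjugated_relator_closed: "conjugated_relator m r h \<in> carrier (free_group 2)"
proof -
  interpret F: group "free_group 2" by (rule group_free_group)
  show ?thesis
    by (simp add: conjugated_relator_def Let_def BS_relator_closed free_gen_closed)
qed

lemma residue_test_closed: "residue_test m r h \<in> carrier (free_group 2)"
proof -
  interpret F: group "free_group 2" by (rule group_free_group)
  show ?thesis
    by (simp add: residue_test_def Let_def conjugated_relator_closed free_gen_closed)
qed

context baumslag_solitar
begin

text \<open>How \<open>a\<^bsup>h\<^esup> b\<^bsup>x\<^esup> a\<^bsup>-h\<^esup>\<close> acts on normal forms.\<close>

definition twist :: "int \<Rightarrow> nat \<Rightarrow> form \<Rightarrow> form" where
  "twist x h t = (cross True ^^ h) (shift x ((cross False ^^ h) t))"

lemma normal_form_cross_pow: "normal_form t \<Longrightarrow> normal_form ((cross s ^^ h) t)"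
  by (induction h) (auto simp: normal_form_cross)

lemma act_gen_0_pow:
  assumes "normal_form t"
  shows "act (free_gen 0 [^]\<^bsub>F\<^esub> (h :: nat)) t = (cross True ^^ h) t"
proof -
  interpret F: group F by (rule group_free_group)
  show ?thesis
    using assms
  proof (induction h arbitrary: t)
    case 0
    then show ?case
      by (simp add: act_one)
  next
    case (Suc h)
    then show ?case
      by (simp add: act_mult normal_form_cross funpow_swap1)
  qed
qed

lemma cross_pow_cancel: "normal_form t \<Longrightarrow> (cross True ^^ h) ((cross False ^^ h) t) = t"
proof (induction h arbitrary: t)
  case (Suc h)
  have "(cross True ^^ Suc h) ((cross False ^^ Suc h) t) =
      cross True ((cross True ^^ h) ((cross False ^^ h) (cross False t)))"
    by (simp add: funpow_swap1)
  then show ?case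
    using Suc cross_cross[of t True] by (simp add: normal_form_cross)
qed simp

lemma act_inv_gen_0_pow:
  assumes "normal_form t"
  shows "act (inv\<^bsub>F\<^esub> (free_gen 0 [^]\<^bsub>F\<^esub> (h :: nat))) t = (cross False ^^ h) t"
proof -
  interpret F: group F by (rule group_free_group)
  let ?t = "(cross False ^^ h) t"
  have "act (inv\<^bsub>F\<^esub> (free_gen 0 [^]\<^bsub>F\<^esub> h)) (act (free_gen 0 [^]\<^bsub>F\<^esub> h) ?t) = ?t"
    by (intro act_inv_cancel normal_form_cross_pow assms) auto
  then show ?thesis
    using assms by (simp add: act_gen_0_pow normal_form_cross_pow cross_pow_cancel)
qed

lemma act_conjugated_relator:
  assumes "normal_form t"
  shows "act (conjugated_relator m r h) t = twist (n - r) h t"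
proof -
  interpret F: group F by (rule group_free_group)
  show ?thesis
    using assms
    by (simp add: conjugated_relator_def Let_def twist_def act_mult BS_relator_closed
        act_inv_gen_0_pow act_gen_0_pow act_BS_relator normal_form_cross_pow normal_form_shift)
qed

lemma twist_multiple: "normal_form t \<Longrightarrow> twist (m ^ h * q) h t = shift (n ^ h * q) t"
proof (induction h arbitrary: q t)
  case (Suc h)
  have "twist (m ^ Suc h * q) (Suc h) t = cross True (twist (m ^ h * (m * q)) h (cross False t))"
    by (simp add: twist_def funpow_swap1 ac_simps)
  also have "\<dots> = cross True (shift (m * (n ^ h * q)) (cross False t))"
    using Suc.IH[of "cross False t" "m * q"] Suc.prems
    by (simp add: normal_form_cross mult.left_commute)
  also have "\<dots> = shift (n ^ Suc h * q) t"
    using Suc.prems cross_shift[of "cross False t" True] cross_cross[of t True]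
    by (simp add: normal_form_cross edge_def mult.assoc)
  finally show ?case .
qed (simp add: twist_def)

text \<open>Let \<open>i < h\<close> be such that \<open>m\<^bsup>i\<^esup>\<close> divides \<open>x\<close> but \<open>m\<^bsup>i + 1\<^esup>\<close> does not. The innermost \<open>i\<close>
  conjugations turn \<open>b\<^bsup>x\<^esup>\<close> into a power of \<open>b\<close> whose exponent is \<open>n\<^bsup>i\<^esup>\<close> times an integer not divisible
  by \<open>m\<close>. As \<open>n\<close> is coprime to \<open>m\<close>, the next conjugation creates no pinch, and the remaining letters
  \<open>a\<close> pile up in front. The last assumption ensures that the letters \<open>a\<^bsup>-1\<^esup>\<close> on the right do not
  cancel against \<open>t\<close>.\<close>

lemma twist_not_multiple:
  assumes "coprime n m" "\<not> m ^ h dvd x" "normal_form t" "\<And>c t'. t \<noteq> Syl c True t'"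
  shows "\<exists>t'. twist x h t = Syl 0 True t'"
  using assms(2-)
proof (induction h arbitrary: t)
  case (Suc h)
  have t: "cross False t = Syl 0 False t"
    using Suc.prems(3) by (cases t) auto
  then have eq: "twist x (Suc h) t = cross True (twist x h (Syl 0 False t))"
    by (simp add: twist_def funpow_swap1)
  have nf: "normal_form (Syl 0 False t)"
    using normal_form_cross[of t False] Suc.prems(2) t by simp
  show ?case
  proof (cases "m ^ h dvd x")
    case True
    then obtain q where q: "x = m ^ h * q"
      by blast
    have "\<not> m dvd q"
      using Suc.prems(1) q by auto
    then have "(n ^ h * q) mod m \<noteq> 0"
      using assms(1) by (metis coprime_dvd_mult_right_iff coprime_commute coprime_power_right_iff
          dvd_eq_mod_eq_0)
    then show ?thesis
      using eq q twist_multiple[OF nf] by (simp add: edge_def)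
  next
    case False
    then obtain t' where "twist x h (Syl 0 False t) = Syl 0 True t'"
      using Suc.IH[of "Syl 0 False t"] nf by auto
    then show ?thesis
      using eq by simp
  qed
qed simp

text \<open>If \<open>m\<^bsup>h\<^esup>\<close> does not divide \<open>n - r\<close>, then the normal form of the conjugate begins with the
  letter \<open>a\<close>, and a further factor \<open>b\<close> on the right leaves this first syllable unchanged. A factor
  \<open>b\<close> on the left turns its residue \<open>0\<close> into \<open>1 mod n\<close>, which is nonzero because \<open>n\<close> is not a
  unit.\<close>

lemma residue_test_trivial_iff:
  assumes "coprime n m" "\<bar>n\<bar> \<noteq> 1"
  shows "word_trivial G (residue_test m r h) \<longleftrightarrow> m ^ h dvd n - r"
proof
  interpret F: group F by (rule group_free_group)
  let ?u = "conjugated_relator m r h"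
  assume triv: "word_trivial G (residue_test m r h)"
  have base: "normal_form (Tail e)" for e
    by (simp add: normal_form_def)
  have b: "act (free_gen 1) t = shift 1 t" for t
    by (simp add: act_def free_gen_def move_def)
  have "?u \<otimes>\<^bsub>F\<^esub> free_gen 1 = residue_test m r h \<otimes>\<^bsub>F\<^esub> (free_gen 1 \<otimes>\<^bsub>F\<^esub> ?u)"
    unfolding residue_test_def Let_def
    by (simp add: F.m_assoc conjugated_relator_closed)
      (simp add: F.m_assoc[symmetric] conjugated_relator_closed)
  then have "act (?u \<otimes>\<^bsub>F\<^esub> free_gen 1) (Tail 0) =
      act (residue_test m r h \<otimes>\<^bsub>F\<^esub> (free_gen 1 \<otimes>\<^bsub>F\<^esub> ?u)) (Tail 0)"
    by simp
  also have "\<dots> = act (free_gen 1 \<otimes>\<^bsub>F\<^esub> ?u) (Tail 0)"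
    using triv
    by (simp add: act_mult residue_test_closed conjugated_relator_closed base trivial_imp_act
        normal_form_act)
  finally have eq: "act ?u (Tail 1) = shift 1 (act ?u (Tail 0))"
    by (simp add: act_mult conjugated_relator_closed base b[unfolded One_nat_def])
  show "m ^ h dvd n - r"
  proof (rule ccontr)
    assume "\<not> m ^ h dvd n - r"
    then have "\<exists>t'. act ?u (Tail e) = Syl 0 True t'" for e
      using twist_not_multiple[OF assms(1)] base by (simp add: act_conjugated_relator)
    then obtain t t' where "Syl 0 True t = shift 1 (Syl 0 True t')"
      using eq by metis
    then have "1 mod n = 0"
      by (simp add: edge_def)
    then have "n dvd 1"
      by (simp add: dvd_eq_mod_eq_0)
    then show False
      using assms(2) by simp
  qed
next
  interpret \<pi>: group_hom F "fst G" "word_eval G"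
    by (rule group_hom_word_eval[OF marked_G])
  let ?u = "conjugated_relator m r h"
  assume "m ^ h dvd n - r"
  then obtain q where q: "n - r = m ^ h * q"
    by blast
  have gens: "word_eval G (free_gen 0) = A" "word_eval G (free_gen (Suc 0)) = B"
    by (simp_all add: word_eval_gen[OF marked_G])
  have "word_eval G (BS_relator m r) = B [^]\<^bsub>fst G\<^esub> (n - r)"
    unfolding eval_BS_relator[OF marked_G] G.relation by (simp add: G.int_pow_diff)
  then have "word_eval G ?u =
      A [^]\<^bsub>fst G\<^esub> h \<otimes>\<^bsub>fst G\<^esub> B [^]\<^bsub>fst G\<^esub> (m ^ h * q) \<otimes>\<^bsub>fst G\<^esub> inv\<^bsub>fst G\<^esub> (A [^]\<^bsub>fst G\<^esub> h)"
    by (simp add: conjugated_relator_def Let_def BS_relator_closed \<pi>.hom_nat_pow gens q)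
  also have "\<dots> = B [^]\<^bsub>fst G\<^esub> (n ^ h * q)"
    unfolding G.conjugate_iterated by (simp add: G.m_assoc)
  finally have u: "word_eval G ?u = B [^]\<^bsub>fst G\<^esub> (n ^ h * q)" .
  have "B [^]\<^bsub>fst G\<^esub> (n ^ h * q) \<otimes>\<^bsub>fst G\<^esub> B = B \<otimes>\<^bsub>fst G\<^esub> B [^]\<^bsub>fst G\<^esub> (n ^ h * q)"
    using G.int_pow_mult[of B "n ^ h * q" 1] G.int_pow_mult[of B 1 "n ^ h * q"]
    by (simp add: add.commute)
  then have "word_eval G (residue_test m r h) = \<one>\<^bsub>fst G\<^esub>"
    by (simp add: residue_test_def Let_def conjugated_relator_closed gens u)
      (simp add: G.m_assoc)
  then show "word_trivial G (residue_test m r h)"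
    by (simp add: word_trivial_def)
qed

end

section \<open>Words along a sequence of parameters\<close>

lemma dvd_poly_iff_dvd_coeff_0: "x dvd poly P x \<longleftrightarrow> x dvd coeff P 0" for x :: int
  by (cases P) (simp add: dvd_add_left_iff)

locale stabilizing_parameters =
  fixes m :: int and k :: "nat \<Rightarrow> int"
  assumes m_nonzero: "m \<noteq> 0" and k_nonzero: "k j \<noteq> 0" and k_coprime: "coprime (k j) m"
    and k_at_top: "filterlim (\<lambda>j. \<bar>k j\<bar>) at_top sequentially"
    and k_residues: "h \<ge> 1 \<Longrightarrow> \<exists>r. \<forall>\<^sub>F j in sequentially. [k j = r] (mod m ^ h)"
begin

sublocale BS: baumslag_solitar m "k j" for j
  by unfold_locales (rule m_nonzero k_nonzero)+

text \<open>Sequences that are eventually \<open>P(k j) / m\<^bsup>N\<^esup>\<close> for a polynomial \<open>P\<close>. The exponents on the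
  stack are of this kind, since they arise from constants by addition, by multiplication with \<open>m\<close> or
  \<open>k j\<close>, and by exact division by \<open>m\<close> or \<open>k j\<close>.\<close>

definition polynomial_in_k :: "(nat \<Rightarrow> int) \<Rightarrow> bool" where
  "polynomial_in_k f \<longleftrightarrow> (\<exists>N P. \<forall>\<^sub>F j in sequentially. m ^ N * f j = poly P (k j))"

lemma eventually_abs_gt: "\<forall>\<^sub>F j in sequentially. c < \<bar>k j\<bar>"
  using k_at_top[unfolded filterlim_at_top, THEN spec, of "c + 1"]
  by eventually_elim simp

lemma k_dvd_cancel: "k j dvd m ^ N * x \<longleftrightarrow> k j dvd x"
  using k_coprime[of j] by (simp add: coprime_dvd_mult_right_iff)

lemma polynomial_in_k_const: "polynomial_in_k (\<lambda>j. c)"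
  unfolding polynomial_in_k_def by (rule exI[of _ 0], rule exI[of _ "[:c:]"]) simp

lemma polynomial_in_k_add:
  assumes "polynomial_in_k f" "polynomial_in_k g"
  shows "polynomial_in_k (\<lambda>j. f j + g j)"
proof -
  obtain N P M Q where "\<forall>\<^sub>F j in sequentially. m ^ N * f j = poly P (k j)"
    "\<forall>\<^sub>F j in sequentially. m ^ M * g j = poly Q (k j)"
    using assms by (auto simp: polynomial_in_k_def)
  then have "\<forall>\<^sub>F j in sequentially. m ^ (N + M) * (f j + g j) =
      poly (smult (m ^ M) P + smult (m ^ N) Q) (k j)"
    by eventually_elim (simp add: power_add algebra_simps)
  then show ?thesis
    unfolding polynomial_in_k_def by blast
qed

lemma polynomial_in_k_edge:
  assumes "polynomial_in_k f"
  shows "polynomial_in_k (\<lambda>j. BS.edge j s * f j)"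
proof -
  obtain N P where P: "\<forall>\<^sub>F j in sequentially. m ^ N * f j = poly P (k j)"
    using assms by (auto simp: polynomial_in_k_def)
  have "\<forall>\<^sub>F j in sequentially. m ^ N * (BS.edge j s * f j) =
      poly (if s then pCons 0 P else smult m P) (k j)"
    using P by eventually_elim (simp add: BS.edge_def mult.left_commute)
  then show ?thesis
    unfolding polynomial_in_k_def by blast
qed

lemma eventually_dvd_coeff_0:
  assumes "\<forall>\<^sub>F j in sequentially. m ^ N * f j = poly P (k j)"
  shows "\<forall>\<^sub>F j in sequentially. k j dvd f j \<longleftrightarrow> coeff P 0 = 0"
  using assms eventually_abs_gt[of "\<bar>coeff P 0\<bar>"]
proof eventually_elim
  case (elim j)
  have "k j dvd f j \<longleftrightarrow> k j dvd coeff P 0"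
    using dvd_poly_iff_dvd_coeff_0[of "k j" P] k_dvd_cancel[of j N "f j"] elim(1) by simp
  then show ?case
    using elim(2) dvd_imp_le_int[of "coeff P 0" "k j"] by auto
qed

text \<open>These are the decisions made by \<open>push\<close>. Divisibility by \<open>k j\<close> concerns only the constant
  coefficient of \<open>P\<close>, which no large \<open>k j\<close> divides unless it is zero. Divisibility by \<open>m\<close> depends
  on \<open>P(k j)\<close> modulo \<open>m\<^bsup>N + 1\<^esup>\<close> only, hence on the eventually constant residue of \<open>k j\<close>.\<close>

lemma eventually_decided_dvd:
  assumes "polynomial_in_k f"
  shows "eventually_decided (\<lambda>j. BS.edge j s dvd f j)"
proof -
  obtain N P where P: "\<forall>\<^sub>F j in sequentially. m ^ N * f j = poly P (k j)"
    using assms by (auto simp: polynomial_in_k_def)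
  show ?thesis
  proof (cases s)
    case True
    then show ?thesis
      using eventually_decided_cong[OF eventually_dvd_coeff_0[OF P]]
      by (simp add: BS.edge_def eventually_decided_const)
  next
    case False
    obtain r where "\<forall>\<^sub>F j in sequentially. [k j = r] (mod m ^ Suc N)"
      using k_residues[of "Suc N"] by auto
    with P have "\<forall>\<^sub>F j in sequentially. BS.edge j s dvd f j \<longleftrightarrow> m ^ Suc N dvd poly P r"
    proof eventually_elim
      case (elim j)
      have "[poly P (k j) = poly P r] (mod m ^ Suc N)"
        using elim(2) by (induction P) (auto intro: cong_add cong_mult)
      then have "m ^ Suc N dvd m ^ N * f j \<longleftrightarrow> m ^ Suc N dvd poly P r"
        using elim(1) by (simp add: cong_dvd_iff)
      then show ?case
        using False m_nonzero by (simp add: BS.edge_def mult.commute[of m])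
    qed
    then show ?thesis
      by (simp add: eventually_decided_cong eventually_decided_const)
  qed
qed

text \<open>Division by \<open>k j\<close> stays within the class: eventual divisibility forces the constant
  coefficient to vanish, so that the polynomial itself can be divided.\<close>

lemma polynomial_in_k_div:
  assumes "polynomial_in_k f" "\<forall>\<^sub>F j in sequentially. BS.edge j s dvd f j"
  shows "polynomial_in_k (\<lambda>j. f j div BS.edge j s)"
proof -
  obtain N P where P: "\<forall>\<^sub>F j in sequentially. m ^ N * f j = poly P (k j)"
    using assms by (auto simp: polynomial_in_k_def)
  show ?thesis
  proof (cases s)
    case True
    have "\<forall>\<^sub>F j in sequentially. coeff P 0 = 0"
      using eventually_dvd_coeff_0[OF P] assms(2)
      by eventually_elim (use True in \<open>simp add: BS.edge_def\<close>)
    then have "coeff P 0 = 0"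
      by simp
    then obtain Q where Q: "P = pCons 0 Q"
      by (cases P) auto
    have "\<forall>\<^sub>F j in sequentially. m ^ N * (f j div BS.edge j s) = poly Q (k j)"
      using P assms(2)
    proof eventually_elim
      case (elim j)
      then obtain x where x: "f j = k j * x"
        using True by (auto simp: BS.edge_def)
      then have "k j * (m ^ N * x) = k j * poly Q (k j)"
        using elim(1) Q by (simp add: mult.left_commute)
      then show ?case
        using True x k_nonzero[of j] by (simp add: BS.edge_def)
    qed
    then show ?thesis
      unfolding polynomial_in_k_def by blast
  next
    case False
    have "\<forall>\<^sub>F j in sequentially. m ^ Suc N * (f j div BS.edge j s) = poly P (k j)"
      using P assms(2)
    proof eventually_elim
      case (elim j)
      then obtain x where "f j = m * x"
        using False by (auto simp: BS.edge_def)
      then show ?case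
        using elim(1) False m_nonzero by (simp add: BS.edge_def mult.left_commute)
    qed
    then show ?thesis
      unfolding polynomial_in_k_def by blast
  qed
qed

lemma eventually_decided_zero:
  assumes "polynomial_in_k f"
  shows "eventually_decided (\<lambda>j. f j = 0)"
proof -
  obtain N P where P: "\<forall>\<^sub>F j in sequentially. m ^ N * f j = poly P (k j)"
    using assms by (auto simp: polynomial_in_k_def)
  show ?thesis
  proof (cases "P = 0")
    case True
    have "\<forall>\<^sub>F j in sequentially. f j = 0"
      using P by eventually_elim (use True m_nonzero in auto)
    then show ?thesis
      by (simp add: eventually_decided_def)
  next
    case False
    define c where "c = Max (insert 0 (abs ` {x. poly P x = 0}))"
    have bound: "\<bar>x\<bar> \<le> c" if "poly P x = 0" for x
      unfolding c_def using poly_roots_finite[OF False] that by (intro Max_ge) auto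
    have "\<forall>\<^sub>F j in sequentially. f j \<noteq> 0"
      using P eventually_abs_gt[of c]
    proof eventually_elim
      case (elim j)
      then show ?case
        using bound[of "k j"] by force
    qed
    then show ?thesis
      by (simp add: eventually_decided_def)
  qed
qed

text \<open>Families of forms with a fixed sequence of stable letters.\<close>

inductive polynomial_form :: "(nat \<Rightarrow> form) \<Rightarrow> bool" where
  Tail: "polynomial_in_k f \<Longrightarrow> polynomial_form (\<lambda>j. Tail (f j))"
| Syl: "polynomial_in_k f \<Longrightarrow> polynomial_form T \<Longrightarrow> polynomial_form (\<lambda>j. Syl (f j) s (T j))"

lemma polynomial_form_add_head:
  assumes "polynomial_in_k f" "polynomial_form T"
  shows "polynomial_form (\<lambda>j. add_head (f j) (T j))"
  using assms(2)
proof cases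
  case (Tail g)
  then show ?thesis
    using assms(1) by (auto intro!: polynomial_form.Tail polynomial_in_k_add)
next
  case (Syl g T' s)
  then show ?thesis
    using assms(1) by (auto intro!: polynomial_form.Syl polynomial_in_k_add)
qed

lemma polynomial_form_push:
  assumes "polynomial_form T"
  shows "\<exists>T'. polynomial_form T' \<and> (\<forall>\<^sub>F j in sequentially. BS.push j s (T j) = T' j)"
proof -
  have pushed: ?thesis if "\<forall>\<^sub>F j in sequentially. BS.push j s (T j) = Syl 0 s (T j)"
    using that polynomial_form.Syl[OF polynomial_in_k_const[of 0] assms, of s] by blast
  show ?thesis
    using assms
  proof cases
    case (Tail g)
    then show ?thesis
      by (intro pushed) simp
  next
    case (Syl g T' s')
    consider "s' \<noteq> (\<not> s) \<or> (\<forall>\<^sub>F j in sequentially. \<not> BS.edge j s' dvd g j)"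
      | "s' = (\<not> s)" "\<forall>\<^sub>F j in sequentially. BS.edge j s' dvd g j"
      using eventually_decided_dvd[OF Syl(2), of s'] unfolding eventually_decided_def by blast
    then show ?thesis
    proof cases
      case 1
      then show ?thesis
        using Syl(1) by (intro pushed) (auto elim!: eventually_mono)
    next
      case 2
      let ?T = "\<lambda>j. add_head (BS.edge j s * (g j div BS.edge j s')) (T' j)"
      have "polynomial_form ?T"
        by (intro polynomial_form_add_head polynomial_in_k_edge polynomial_in_k_div Syl 2)
      moreover have "\<forall>\<^sub>F j in sequentially. BS.push j s (T j) = ?T j"
        using 2(2) by eventually_elim (simp add: Syl(1) 2(1))
      ultimately show ?thesis
        by blast
    qed
  qed
qed

text \<open>Since the decisions are eventually the same for all \<open>j\<close>, the algorithm removes the same pinches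
  for all large \<open>j\<close>.\<close>

lemma eventually_polynomial_stack:
  "\<exists>T. polynomial_form T \<and> (\<forall>\<^sub>F j in sequentially. BS.stack j w = T j)"
proof (induction w)
  case Nil
  show ?case
    using polynomial_form.Tail[OF polynomial_in_k_const[of 0]]
    by (auto simp: BS.stack_def)
next
  case (Cons x w)
  then obtain T where T: "polynomial_form T" "\<forall>\<^sub>F j in sequentially. BS.stack j w = T j"
    by blast
  have "\<exists>T'. polynomial_form T' \<and> (\<forall>\<^sub>F j in sequentially. BS.stack_step j x (T j) = T' j)"
  proof (cases "fst x = 0")
    case True
    then show ?thesis
      using polynomial_form_push[OF T(1)] by (simp add: BS.stack_step_def)
  next
    case False
    then show ?thesis
      using polynomial_form_add_head[OF polynomial_in_k_const[of "if snd x then 1 else - 1"] T(1)]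
      by (intro exI[of _ "\<lambda>j. add_head (if snd x then 1 else - 1) (T j)"])
        (simp add: BS.stack_step_def)
  qed
  then obtain T' where T': "polynomial_form T'"
    "\<forall>\<^sub>F j in sequentially. BS.stack_step j x (T j) = T' j"
    by blast
  have "\<forall>\<^sub>F j in sequentially. BS.stack j (x # w) = T' j"
    using T(2) T'(2) by eventually_elim (simp add: BS.stack_def)
  then show ?case
    using T'(1) by blast
qed

lemma eventually_decided_word_trivial:
  assumes "w \<in> carrier (free_group 2)"
  shows "eventually_decided (\<lambda>j. word_trivial (presented 2 {BS_relator m (k j)}) w)"
proof -
  obtain T where T: "polynomial_form T" "\<forall>\<^sub>F j in sequentially. BS.stack j w = T j"
    using eventually_polynomial_stack by blast
  have "eventually_decided (\<lambda>j. T j = Tail 0)"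
    using T(1)
  proof cases
    case (Tail f)
    then show ?thesis
      using eventually_decided_zero by simp
  qed (simp add: eventually_decided_const)
  moreover have "\<forall>\<^sub>F j in sequentially.
      word_trivial (presented 2 {BS_relator m (k j)}) w \<longleftrightarrow> T j = Tail 0"
    using T(2) by eventually_elim (simp add: BS.word_trivial_iff_stack[OF assms])
  ultimately show ?thesis
    by (simp add: eventually_decided_cong)
qed

end

section \<open>The convergence criterion\<close>

lemma convergent_BS_iff:
  "(\<exists>L. limitin (marked_topology 2) (\<lambda>j. BS m (k j)) L sequentially) \<longleftrightarrow>
    (\<forall>w\<in>carrier (free_group 2).
      eventually_decided (\<lambda>j. word_trivial (presented 2 {BS_relator m (k j)}) w))"
  unfolding BS_def
  by (rule convergent_marked_iff) (simp add: marked_group_presented BS_relator_closed)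

text \<open>If \<open>k\<close> eventually differs from each single integer, then it eventually leaves each bounded
  interval, because such an interval contains only finitely many integers.\<close>

lemma eventually_constant_or_abs_at_top:
  fixes k :: "nat \<Rightarrow> int"
  assumes "\<And>c. eventually_decided (\<lambda>j. k j = c)"
  shows "(\<exists>c. \<forall>\<^sub>F j in sequentially. k j = c) \<or> filterlim (\<lambda>j. \<bar>k j\<bar>) at_top sequentially"
proof (rule disjCI)
  assume not_at_top: "\<not> filterlim (\<lambda>j. \<bar>k j\<bar>) at_top sequentially"
  show "\<exists>c. \<forall>\<^sub>F j in sequentially. k j = c"
  proof (rule ccontr)
    assume "\<nexists>c. \<forall>\<^sub>F j in sequentially. k j = c"
    then have ne: "\<forall>\<^sub>F j in sequentially. k j \<noteq> c" for c
      using assms by (auto simp: eventually_decided_def)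
    have "\<forall>\<^sub>F j in sequentially. Z \<le> \<bar>k j\<bar>" for Z
    proof -
      have "\<forall>\<^sub>F j in sequentially. \<forall>c\<in>{- Z..Z}. k j \<noteq> c"
        by (intro eventually_ball_finite ballI ne) simp
      then show ?thesis
        by eventually_elim force
    qed
    then show False
      using not_at_top by (simp add: filterlim_at_top)
  qed
qed

theorem theorem3:
  fixes m :: int and k :: "nat \<Rightarrow> int"
  assumes "m \<noteq> 0"
    and "\<And>j. k j \<noteq> 0"
    and "\<And>j. coprime (k j) m"
  defines "a \<equiv> (\<exists>c. \<forall>\<^sub>F j in sequentially. k j = c)"
    and "b \<equiv> filterlim (\<lambda>j. \<bar>k j\<bar>) at_top sequentially \<and>
      (\<forall>h::nat\<ge>1. \<exists>r. \<forall>\<^sub>F j in sequentially. [k j = r] (mod m ^ h))"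
  shows "(\<exists>L. limitin (marked_topology 2) (\<lambda>j. BS m (k j)) L sequentially) \<longleftrightarrow>
    (a \<or> b) \<and> \<not> (a \<and> b)"
proof -
  interpret BS: baumslag_solitar m "k j" for j
    using assms(1,2) by unfold_locales
  let ?X = "\<lambda>j. presented 2 {BS_relator m (k j)}"
  have exclusive: "\<not> (a \<and> b)"
  proof
    assume "a \<and> b"
    then obtain c where "\<forall>\<^sub>F j in sequentially. k j = c"
      and "filterlim (\<lambda>j. \<bar>k j\<bar>) at_top sequentially"
      by (auto simp: a_def b_def)
    then have "\<forall>\<^sub>F j in sequentially. k j = c \<and> \<bar>c\<bar> + 1 \<le> \<bar>k j\<bar>"
      by (simp add: filterlim_at_top eventually_conj)
    then have "\<forall>\<^sub>F j :: nat in sequentially. False"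
      by eventually_elim auto
    then show False
      by simp
  qed
  have "(\<forall>w\<in>carrier (free_group 2). eventually_decided (\<lambda>j. word_trivial (?X j) w)) \<longleftrightarrow> a \<or> b"
  proof
    assume stable: "\<forall>w\<in>carrier (free_group 2). eventually_decided (\<lambda>j. word_trivial (?X j) w)"
    have "eventually_decided (\<lambda>j. k j = c)" for c
      using stable[rule_format, OF BS_relator_closed[of m c]] by (simp add: BS.relator_trivial_iff)
    then have "a \<or> filterlim (\<lambda>j. \<bar>k j\<bar>) at_top sequentially"
      unfolding a_def by (rule eventually_constant_or_abs_at_top)
    moreover have b if at_top: "filterlim (\<lambda>j. \<bar>k j\<bar>) at_top sequentially"
      unfolding b_def
    proof (intro conjI allI impI at_top)
      fix h :: nat
      \<comment> \<open>units have to be excluded for \<open>residue_test\<close> to detect the residue\<close>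
      have large: "\<forall>\<^sub>F j in sequentially. 2 \<le> \<bar>k j\<bar>"
        using at_top by (simp add: filterlim_at_top)
      have test: "\<forall>\<^sub>F j in sequentially.
          word_trivial (?X j) (residue_test m r h) \<longleftrightarrow> [k j = r] (mod m ^ h)" for r
        using large
        by eventually_elim (simp add: BS.residue_test_trivial_iff assms(3) cong_iff_dvd_diff)
      have residue: "eventually_decided (\<lambda>j. [k j = r] (mod m ^ h))" for r
        using stable[rule_format, OF residue_test_closed[of m r h]] test[of r]
        by (simp add: eventually_decided_cong)
      show "\<exists>r. \<forall>\<^sub>F j in sequentially. [k j = r] (mod m ^ h)"
      proof (rule ccontr)
        assume "\<not> ?thesis"
        then have none: "\<forall>\<^sub>F j in sequentially. \<not> [k j = r] (mod m ^ h)" for r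
          using residue by (auto simp: eventually_decided_def)
        \<comment> \<open>every integer is congruent to an element of this finite interval, for either sign of \<open>m\<close>\<close>
        have "\<forall>\<^sub>F j in sequentially. \<forall>r\<in>{- \<bar>m ^ h\<bar>..\<bar>m ^ h\<bar>}. \<not> [k j = r] (mod m ^ h)"
          by (intro eventually_ball_finite ballI none) simp
        then have "\<forall>\<^sub>F j :: nat in sequentially. False"
        proof eventually_elim
          case (elim j)
          have "k j mod m ^ h \<in> {- \<bar>m ^ h\<bar>..\<bar>m ^ h\<bar>}"
            using abs_mod_less[of "m ^ h" "k j"] assms(1) by (auto simp: abs_less_iff)
          then show ?case
            using elim by (metis cong_mod_right cong_refl)
        qed
        then show False
          by simp
      qed
    qed
    ultimately show "a \<or> b"
      by blast
  next
    assume "a \<or> b"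
    then show "\<forall>w\<in>carrier (free_group 2). eventually_decided (\<lambda>j. word_trivial (?X j) w)"
    proof
      assume a
      then obtain c where c: "\<forall>\<^sub>F j in sequentially. k j = c"
        by (auto simp: a_def)
      show ?thesis
      proof
        fix w
        have "\<forall>\<^sub>F j in sequentially.
            word_trivial (?X j) w \<longleftrightarrow> word_trivial (presented 2 {BS_relator m c}) w"
          using c by eventually_elim simp
        then show "eventually_decided (\<lambda>j. word_trivial (?X j) w)"
          by (simp add: eventually_decided_cong eventually_decided_const)
      qed
    next
      assume b
      then interpret stabilizing_parameters m k
        using assms(1-3) by unfold_locales (auto simp: b_def)
      show ?thesis
        using eventually_decided_word_trivial by blast
    qed
  qed
  then show ?thesis
    unfolding convergent_BS_iff using exclusive by blast
qed

end
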